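(* Let $\vec\xi(j)=\{\xi_\nu(j)\}_{\nu=1}^T$ and $\vec\eta(j)=\{\eta_\nu(j)\}_{\nu=1}^T$, $j\in\mathbb Z$, be mutually uncorrelated $T$-variate stationary stochastic sequences with spectral density matrices $f^{\vec\xi}(\lambda)$ and $f^{\vec\eta}(\lambda)$, and assume the minimality condition $$\int_{-\pi}^{\pi}\operatorname{Tr}\big[(f^{\vec\xi}(\lambda)+f^{\vec\eta}(\lambda))^{-1}\big]\,d\lambda<+\infty .$$ Consider the functional $A_s\vec\xi=\sum_{j\in S}\vec a^{\top}(j)\vec\xi(j)$ and its optimal linear estimate based on observations of $\vec\xi(j)+\vec\eta(j)$ at the points $j\in\mathbb Z\setminus S$. Then the spectral characteristic $\vec h(f^{\vec\xi},f^{\vec\eta})$ of the optimal estimate is $$\vec h^{\top}(f^{\vec\xi},f^{\vec\eta})=\big(A_s^{\top}(e^{i\lambda})f^{\vec\xi}(\lambda)-C_s^{\top}(e^{i\lambda})\big)\big[f^{\vec\xi}(\lambda)+f^{\vec\eta}(\lambda)\big]^{-1} =A_s^{\top}(e^{i\lambda})-\big(A_s^{\top}(e^{i\lambda})f^{\vec\eta}(\lambda)+C_s^{\top}(e^{i\lambda})\big)\big[f^{\vec\xi}(\lambda)+f^{\vec\eta}(\lambda)\big]^{-1},$$ where $A_s(e^{i\lambda})=\sum_{j\in S}\vec a(j)e^{ij\lambda}$, $C_s(e^{i\lambda})=\sum_{k\in S}\vec c(k)e^{ik\lambda}$, and the vector $\vec c_s=(\vec c(k))_{k\in S}$ of unknown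 coefficients is given by $\vec c_s=\mathbf B_s^{-1}\mathbf D_s\vec a_s$. The mean square error of the optimal estimate is $$\Delta(f^{\vec\xi},f^{\vec\eta})=\langle\vec a_s,\mathbf R_s\vec a_s\rangle+\langle\vec c_s,\mathbf B_s\vec c_s\rangle .$$
   Context: Fix integers $T\ge1$, $s\ge1$, $N_1,\dots,N_s\ge1$, $K_1,\dots,K_{s-1}\ge1$; put $N_0=K_0=0$, $M_l=\sum_{k=0}^{l}(N_k+K_k)$, $S=\bigcup_{l=0}^{s-1}\{M_l+1,\dots,M_l+N_{l+1}\}$ and $\rho=N_1+\dots+N_s=|S|$. The vectors $\vec a(j)\in\mathbb C^T$, $j\in S$, are given. A $T$-variate stationary sequence has zero mean, finite second moments and $\mathsf E\xi_\nu(n)\overline{\xi_\mu(m)}$ depending only on $n-m$; it has a spectral representation with an orthogonal vector random measure $Z^{\vec\xi}(d\lambda)$ on $[-\pi,\pi)$. For a matrix density $f$, $L_2(f)$ is the space of vector functions $\vec b$ with $\int_{-\pi}^{\pi}\vec b^{\top}(\lambda)f(\lambda)\overline{\vec b(\lambda)}d\lambda<\infty$, and $L_2^{s-}(f)$ is its closed subspace generated by $e^{ij\lambda}\delta_\nu$, $j\in\mathbb Z\setminus S$, $\nu=1,\dots,T$ ($\delta_\nu$ the $\nu$-th unit vector). A linear estimate of $A_s\vec\xi$ from the observations is $\widehat{A_s\vec\xi}=\int_{-\pi}^{\pi}\vec h^{\top}(e^{i\lambda})(Z^{\vec\xi}(d\lambda)+Z^{\vec\eta}(d\lambda))$ with spectral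 characteristic $\vec h\in L_2^{s-}(f^{\vec\xi}+f^{\vec\eta})$; its mean square error is $\Delta(\vec h;f^{\vec\xi},f^{\vec\eta})=\frac1{2\pi}\int_{-\pi}^{\pi}[A_s(e^{i\lambda})-\vec h(e^{i\lambda})]^{\top}f^{\vec\xi}(\lambda)\overline{[A_s(e^{i\lambda})-\vec h(e^{i\lambda})]}d\lambda+\frac1{2\pi}\int_{-\pi}^{\pi}\vec h^{\top}(e^{i\lambda})f^{\vec\eta}(\lambda)\overline{\vec h(e^{i\lambda})}d\lambda$, and the optimal estimate minimizes it. Vectors $\vec a_s,\vec c_s\in\mathbb C^{T\rho}$ stack $\vec a(j)$, resp. $\vec c(j)$, over $j\in S$ in increasing order. $\mathbf B_s,\mathbf D_s,\mathbf R_s$ are the $T\rho\times T\rho$ matrices whose $T\times T$ blocks indexed by $(k,j)\in S\times S$ are, respectively, $\frac1{2\pi}\int_{-\pi}^{\pi}[(f^{\vec\xi}+f^{\vec\eta})^{-1}]^{\top}e^{i(j-k)\lambda}d\lambda$, $\frac1{2\pi}\int_{-\pi}^{\pi}[f^{\vec\xi}(f^{\vec\xi}+f^{\vec\eta})^{-1}]^{\top}e^{i(j-k)\lambda}d\lambda$, $\frac1{2\pi}\int_{-\pi}^{\pi}[f^{\vec\xi}(f^{\vec\xi}+f^{\vec\eta})^{-1}f^{\vec\eta}]^{\top}e^{i(j-k)\lambda}d\lambda$. $\langle\cdot,\cdot\rangle$ is the scalar product in $\mathbb C^{T\rho}$. *)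

theory Defs
  imports "HOL-Analysis.Analysis"
begin

text \<open>N k for k = 1..s, K k for k = 1..s-1; the conventions N 0 = K 0 = 0 are built in.\<close>

definition Mblk :: "(nat \<Rightarrow> nat) \<Rightarrow> (nat \<Rightarrow> nat) \<Rightarrow> nat \<Rightarrow> int" where
  "Mblk N K l = (\<Sum>k\<in>{0..l}. (if k = 0 then 0 else int (N k) + int (K k)))"

definition S_set :: "nat \<Rightarrow> (nat \<Rightarrow> nat) \<Rightarrow> (nat \<Rightarrow> nat) \<Rightarrow> int set" where
  "S_set s N K = (\<Union>l\<in>{0..<s}. {Mblk N K l + 1 .. Mblk N K l + int (N (l + 1))})"

definition qform :: "complex^'t \<Rightarrow> complex^'t^'t \<Rightarrow> complex" where
  "qform b M = (\<Sum>\<nu>\<in>UNIV. \<Sum>\<mu>\<in>UNIV. b$\<nu> * M$\<nu>$\<mu> * cnj (b$\<mu>))"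

definition herm_psd :: "complex^'t^'t \<Rightarrow> bool" where
  "herm_psd M \<longleftrightarrow> (\<forall>i j. M$i$j = cnj (M$j$i)) \<and> (\<forall>x. 0 \<le> Re (qform x M))"

definition spectral_density :: "(real \<Rightarrow> complex^'t^'t) \<Rightarrow> bool" where
  "spectral_density f \<longleftrightarrow>
     (\<forall>i j. (\<lambda>l. f l $ i $ j) \<in> borel_measurable lborel \<and>
            set_integrable lborel {-pi..pi} (\<lambda>l. f l $ i $ j)) \<and>
     (AE l in lborel. l \<in> {-pi..pi} \<longrightarrow> herm_psd (f l))"

definition L2 :: "(real \<Rightarrow> complex^'t^'t) \<Rightarrow> (real \<Rightarrow> complex^'t) \<Rightarrow> bool" where
  "L2 F b \<longleftrightarrow> b \<in> borel_measurable lborel \<and>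
     set_integrable lborel {-pi..pi} (\<lambda>l. Re (qform (b l) (F l)))"

definition L2dist :: "(real \<Rightarrow> complex^'t^'t) \<Rightarrow> (real \<Rightarrow> complex^'t) \<Rightarrow> (real \<Rightarrow> complex^'t) \<Rightarrow> real" where
  "L2dist F b c = (LINT l:{-pi..pi}|lborel. Re (qform (b l - c l) (F l)))"

definition gen_span :: "int set \<Rightarrow> (real \<Rightarrow> complex^'t) set" where
  "gen_span S = {(\<lambda>l. \<Sum>p\<in>E. w p *s (exp (\<i> * of_int (fst p) * of_real l) *s axis (snd p) 1))
                 | E w. finite E \<and> E \<subseteq> (UNIV - S) \<times> UNIV}"

definition L2s :: "(real \<Rightarrow> complex^'t^'t) \<Rightarrow> int set \<Rightarrow> (real \<Rightarrow> complex^'t) \<Rightarrow> bool" where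
  "L2s F S b \<longleftrightarrow> L2 F b \<and>
     (\<exists>p. (\<forall>n. p n \<in> gen_span S) \<and> (\<lambda>n. L2dist F b (p n)) \<longlonglongrightarrow> 0)"

definition trig_vec :: "int set \<Rightarrow> (int \<Rightarrow> complex^'t) \<Rightarrow> real \<Rightarrow> complex^'t" where
  "trig_vec S a l = (\<Sum>j\<in>S. exp (\<i> * of_int j * of_real l) *s a j)"

definition Delta :: "(real \<Rightarrow> complex^'t^'t) \<Rightarrow> (real \<Rightarrow> complex^'t^'t) \<Rightarrow> (real \<Rightarrow> complex^'t)
                     \<Rightarrow> (real \<Rightarrow> complex^'t) \<Rightarrow> real" where
  "Delta f g A h = 1 / (2 * pi) * (LINT l:{-pi..pi}|lborel. Re (qform (A l - h l) (f l)))
                 + 1 / (2 * pi) * (LINT l:{-pi..pi}|lborel. Re (qform (h l) (g l)))"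

text \<open>Matrices of size T*rho indexed by S x {1..T}: entry ((k,nu),(j,mu)) is the (nu,mu) entry
  of the block (1/2pi) int [M(lambda)]^T e^{i(j-k)lambda} d lambda.\<close>
definition toep :: "(real \<Rightarrow> complex^'t^'t) \<Rightarrow> (int \<times> 't) \<Rightarrow> (int \<times> 't) \<Rightarrow> complex" where
  "toep M p q = complex_of_real (1 / (2 * pi)) *
     (LINT l:{-pi..pi}|lborel. M l $ snd q $ snd p * exp (\<i> * of_int (fst q - fst p) * of_real l))"

definition Bmat where "Bmat f g = toep (\<lambda>l. matrix_inv (f l + g l))"
definition Dmat where "Dmat f g = toep (\<lambda>l. f l ** matrix_inv (f l + g l))"
definition Rmat where "Rmat f g = toep (\<lambda>l. f l ** matrix_inv (f l + g l) ** g l)"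

definition mvec :: "'i set \<Rightarrow> ('i \<Rightarrow> 'i \<Rightarrow> complex) \<Rightarrow> ('i \<Rightarrow> complex) \<Rightarrow> 'i \<Rightarrow> complex" where
  "mvec I M x = (\<lambda>p. \<Sum>q\<in>I. M p q * x q)"

definition cinner :: "'i set \<Rightarrow> ('i \<Rightarrow> complex) \<Rightarrow> ('i \<Rightarrow> complex) \<Rightarrow> complex" where
  "cinner I x y = (\<Sum>p\<in>I. x p * cnj (y p))"

definition is_inv_on :: "'i set \<Rightarrow> ('i \<Rightarrow> 'i \<Rightarrow> complex) \<Rightarrow> ('i \<Rightarrow> 'i \<Rightarrow> complex) \<Rightarrow> bool" where
  "is_inv_on I M N \<longleftrightarrow>
     (\<forall>p\<in>I. \<forall>q\<in>I. (\<Sum>r\<in>I. M p r * N r q) = (if p = q then 1 else 0)) \<and>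
     (\<forall>p\<in>I. \<forall>q\<in>I. (\<Sum>r\<in>I. N p r * M r q) = (if p = q then 1 else 0))"

definition invertible_on :: "'i set \<Rightarrow> ('i \<Rightarrow> 'i \<Rightarrow> complex) \<Rightarrow> bool" where
  "invertible_on I M \<longleftrightarrow> (\<exists>N. is_inv_on I M N)"

definition mat_inv_on :: "'i set \<Rightarrow> ('i \<Rightarrow> 'i \<Rightarrow> complex) \<Rightarrow> 'i \<Rightarrow> 'i \<Rightarrow> complex" where
  "mat_inv_on I M = (SOME N. is_inv_on I M N)"

definition stack :: "(int \<Rightarrow> complex^'t) \<Rightarrow> int \<times> 't \<Rightarrow> complex" where
  "stack a p = a (fst p) $ snd p"

definition unstack :: "(int \<times> 't \<Rightarrow> complex) \<Rightarrow> int \<Rightarrow> complex^'t" where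
  "unstack c k = (\<chi> \<nu>. c (k, \<nu>))"

end

theory Submission
  imports Defs
begin

text \<open>Write \<open>F = f + g\<close> and \<open>G = F\<^sup>-\<^sup>1\<close>. Minimality and the Cauchy--Schwarz inequality make every coordinate
  functional \<open>b \<mapsto> \<integral> b\<^sub>\<nu> e\<^sup>-\<^sup>i\<^sup>k\<^sup>\<lambda>\<close> continuous on \<open>L\<^sub>2(F)\<close>, and trigonometric polynomials are dense
  there, so the observation space consists exactly of the elements of \<open>L\<^sub>2(F)\<close> whose Fourier coefficients
  vanish on \<open>S\<close>. The equation \<open>B c = D a\<close> says that \<open>h\<close> has this property, while \<open>A f - h F = C\<close>
  has frequencies in \<open>S\<close> only and is thus orthogonal to the observation space. Hence
  \<open>\<Delta>(h') - \<Delta>(h)\<close> is the squared \<open>L\<^sub>2(F)\<close> distance of \<open>h'\<close> and \<open>h\<close> up to the factor \<open>1/2\<pi>\<close>.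
  The value of the error comes from a pointwise matrix identity, and \<open>B\<close> is invertible because its
  quadratic form is the integral of that of \<open>G\<close> along a trigonometric polynomial.\<close>

section \<open>Hermitian positive semidefinite matrices\<close>

text \<open>Vectors act as rows, \<open>b v* M\<close>, and \<open>cdot\<close> conjugates its
  second argument, so a quadratic form is \<open>cdot (b v* M) b\<close>. Cauchy--Schwarz is used
  pointwise and additively: 2|<xM, y>| <= t q(x) + q(y)/t, with q the form of M and t > 0 free. The
  right side is then a sum of two integrable functions, so a single a.e. inequality gives
  integrability and, after integration, a bound; choosing t at the end recovers continuity. The link
  to minimality is that the i-th coordinate is represented in the form of F by the i-th row of G,
  and the F-form of that row is G_ii. \<open>L2dist\<close> is a squared distance, whence the
  factors 2 that come from the parallelogram law. The analytic obstacle is density. F is merely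
  integrable, so the approximants have to be dominated: bounded functions are approximated a.e. by
  trigonometric polynomials under one common bound, and unbounded functions are truncated
  first.\<close>

definition cdot :: "complex^'t \<Rightarrow> complex^'t \<Rightarrow> complex" where
  "cdot x y = (\<Sum>i\<in>UNIV. x$i * cnj (y$i))"

lemma cdot_simps:
  "cdot (x + y) z = cdot x z + cdot y z"
  "cdot (x - y) z = cdot x z - cdot y z"
  "cdot z (x + y) = cdot z x + cdot z y"
  "cdot z (x - y) = cdot z x - cdot z y"
  "cdot (c *s x) z = c * cdot x z"
  "cdot z (c *s x) = cnj c * cdot z x"
  by (simp_all add: cdot_def sum.distrib sum_subtractf sum_distrib_left algebra_simps)

lemma cnj_cdot: "cnj (cdot x y) = cdot y x"
  by (simp add: cdot_def mult.commute)

lemma cdot_axis: "cdot x (axis i 1) = x $ i" "cdot (axis i 1) x = cnj (x $ i)"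
  by (simp_all add: cdot_def axis_def if_distrib if_distribR cong: if_cong)

lemma axis_vector_matrix_mult: "(axis i 1 v* M) $ j = (M $ i $ j :: complex)"
  by (simp add: vector_matrix_mult_def axis_def if_distrib if_distribR cong: if_cong)

text \<open>Reduces computations with quadratic forms to sesquilinear expansion, where a Hermitian
  matrix can be moved from one argument of \<open>cdot\<close> to the other.\<close>

lemma qform_eq_cdot: "qform b M = cdot (b v* M) b"
  unfolding qform_def cdot_def vector_matrix_mult_def
  by (simp add: sum_distrib_right) (rule sum.swap)

lemma cdot_hermitian:
  assumes "\<forall>i j. M$i$j = cnj (M$j$i)"
  shows "cdot (x v* M) y = cdot x (y v* M)"
proof -
  have "cdot (x v* M) y = (\<Sum>j\<in>UNIV. \<Sum>i\<in>UNIV. x$i * M$i$j * cnj (y$j))"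
    by (simp add: cdot_def vector_matrix_mult_def sum_distrib_right)
  also have "\<dots> = (\<Sum>i\<in>UNIV. \<Sum>j\<in>UNIV. x$i * M$i$j * cnj (y$j))"
    by (rule sum.swap)
  also have "\<dots> = cdot x (y v* M)"
    unfolding cdot_def vector_matrix_mult_def
    by (simp add: sum_distrib_left mult_ac assms[rule_format, symmetric])
  finally show ?thesis .
qed

lemma herm_psdD:
  assumes "herm_psd M"
  shows "cdot (x v* M) y = cdot x (y v* M)" "0 \<le> Re (qform x M)"
  using assms cdot_hermitian unfolding herm_psd_def by blast+

lemma qform_real:
  assumes "herm_psd M" shows "complex_of_real (Re (qform x M)) = qform x M"
proof -
  have "cnj (qform x M) = qform x M"
    by (simp add: qform_eq_cdot cnj_cdot herm_psdD(1)[OF assms])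
  then show ?thesis by (metis Reals_cnj_iff of_real_Re)
qed

lemma qform_axis: "qform (axis i 1) M = M $ i $ i"
  by (simp add: qform_eq_cdot cdot_axis axis_vector_matrix_mult)

lemma herm_psd_diag_nonneg: "herm_psd M \<Longrightarrow> 0 \<le> Re (M $ i $ i)"
  using herm_psdD(2)[of M "axis i 1"] by (simp add: qform_axis)

lemma qform_add_matrix: "qform x (M + N) = qform x M + qform x N"
  by (simp add: qform_eq_cdot vector_matrix_mult_add_rdistrib cdot_simps)

lemma qform_minus: "qform (- x) M = qform x M"
  by (simp add: qform_def)

lemma herm_psd_add: "herm_psd M \<Longrightarrow> herm_psd N \<Longrightarrow> herm_psd (M + N)"
  unfolding herm_psd_def qform_add_matrix plus_complex.sel vector_add_component complex_cnj_add
  by (metis add_nonneg_nonneg)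

text \<open>The form is nonnegative at \<open>x - w *s y\<close>; a unimodular \<open>w\<close>
  aligned with the phase of the mixed term turns that term into minus twice its modulus.\<close>

lemma psd_cauchy_schwarz:
  assumes "herm_psd M"
  shows "2 * cmod (cdot (x v* M) y) \<le> Re (qform x M) + Re (qform y M)"
proof -
  define z where "z = cdot (x v* M) y"
  \<comment> \<open>\<open>w\<close> is the phase of \<open>z\<close>; any unimodular number serves
    when \<open>z = 0\<close>.\<close>
  obtain w where w: "cmod w = 1" "cnj w * z = of_real (cmod z)"
  proof (cases "z = 0")
    case True
    then show ?thesis using that[of 1] by simp
  next
    case False
    have "cnj (sgn z) * z = of_real (cmod z)"
      by (simp add: sgn_eq complex_norm_square[symmetric] mult.commute[of "cnj z"] power2_eq_square)
    then show ?thesis using that[of "sgn z"] False by (simp add: norm_sgn)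
  qed
  have ww: "w * cnj w = 1" using w(1) by (simp add: complex_norm_square[symmetric])
  have "qform (x - w *s y) M = qform x M - cnj w * z - w * cnj z + w * cnj w * qform y M"
    unfolding z_def
    by (simp add: qform_eq_cdot vector_matrix_mult_diff_distrib vector_scalar_commute cdot_simps cnj_cdot
       herm_psdD(1)[OF assms] scalar_vector_matrix_assoc algebra_simps)
  also have "w * cnj z = cnj (cnj w * z)" by simp
  finally have "qform (x - w *s y) M = qform x M - 2 * of_real (cmod z) + qform y M"
    using w(2) ww by simp
  then have "Re (qform (x - w *s y) M) = Re (qform x M) - 2 * cmod z + Re (qform y M)" by simp
  with herm_psdD(2)[OF assms, of "x - w *s y"] show ?thesis by (simp add: z_def)
qed

lemma qform_scale: "qform (c *s x) M = of_real ((cmod c)\<^sup>2) * qform x M"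
  unfolding complex_norm_square
  by (simp add: qform_eq_cdot scalar_vector_matrix_assoc cdot_simps mult.assoc)

text \<open>Scaling \<open>x\<close> by the square root of \<open>t\<close> and \<open>y\<close> by
  its inverse keeps the mixed term and redistributes the weight between the two forms.\<close>

lemma psd_cauchy_schwarz_weighted:
  assumes "herm_psd M" "0 < t"
  shows "2 * cmod (cdot (x v* M) y) \<le> t * Re (qform x M) + Re (qform y M) / t"
proof -
  let ?s = "complex_of_real (sqrt t)"
  have "cdot ((?s *s x) v* M) (inverse ?s *s y) = cdot (x v* M) y"
    using assms(2) by (simp add: scalar_vector_matrix_assoc cdot_simps)
  moreover have "Re (qform (?s *s x) M) = t * Re (qform x M)"
    using assms(2) by (simp add: qform_scale)
  moreover have "Re (qform (inverse ?s *s y) M) = Re (qform y M) / t"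
    using assms(2) by (simp add: qform_scale norm_inverse norm_divide field_simps power2_eq_square)
  ultimately show ?thesis
    using psd_cauchy_schwarz[OF assms(1), of "?s *s x" "inverse ?s *s y"] by simp
qed

text \<open>Parallelogram law with the form of the difference dropped; it stands in for the triangle
  inequality of squared norms.\<close>

lemma qform_add_le:
  assumes "herm_psd M"
  shows "Re (qform (x + y) M) \<le> 2 * Re (qform x M) + 2 * Re (qform y M)"
proof -
  have "qform (x + y) M + qform (x - y) M = 2 * qform x M + 2 * qform y M"
    by (simp add: qform_eq_cdot vector_matrix_left_distrib vector_matrix_mult_diff_distrib cdot_simps)
  then have "Re (qform (x + y) M) + Re (qform (x - y) M) = 2 * Re (qform x M) + 2 * Re (qform y M)"
    by (simp add: complex_eq_iff)
  with herm_psdD(2)[OF assms, of "x - y"] show ?thesis by simp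
qed

lemma qform_diff_le:
  assumes "herm_psd M"
  shows "Re (qform (x - y) M) \<le> 2 * Re (qform x M) + 2 * Re (qform y M)"
  using qform_add_le[OF assms, of x "- y"] by (simp add: qform_minus)

lemma psd_entry_le:
  assumes "herm_psd M"
  shows "2 * cmod (M $ i $ j) \<le> Re (M $ i $ i) + Re (M $ j $ j)"
  using psd_cauchy_schwarz[OF assms, of "axis i 1" "axis j 1"]
  by (simp add: qform_axis cdot_axis axis_vector_matrix_mult)

text \<open>Every diagonal entry is nonnegative and hence at most the trace, and an off-diagonal
  entry is at most the mean of two diagonal ones. This is how a bound on the trace alone controls a
  whole matrix.\<close>

lemma psd_entry_le_trace:
  assumes "herm_psd M"
  shows "cmod (M $ i $ j) \<le> Re (trace M)"
proof -
  have "Re (M $ k $ k) \<le> Re (trace M)" for k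
    unfolding trace_def Re_sum
    by (rule member_le_sum) (auto intro: herm_psd_diag_nonneg assms)
  from this[of i] this[of j] psd_entry_le[OF assms, of i j] show ?thesis by linarith
qed

text \<open>A crude count over all entries. Only the shape matters: an integrable factor times the
  squared length of the vector, as dominated convergence requires.\<close>

lemma psd_qform_le_trace:
  fixes M :: "complex^'t^'t"
  assumes "herm_psd M"
  shows "Re (qform x M) \<le> (real CARD('t))\<^sup>2 * Re (trace M) * (norm x)\<^sup>2"
proof -
  have tr: "0 \<le> Re (trace M)"
    using psd_entry_le_trace[OF assms] norm_ge_zero order_trans by blast
  have "Re (qform x M) \<le> cmod (qform x M)" by (rule complex_Re_le_cmod)
  also have "\<dots> \<le> (\<Sum>i\<in>UNIV. \<Sum>j\<in>UNIV. cmod (x$i * M$i$j * cnj (x$j)))"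
    unfolding qform_def by (intro sum_norm_le order_refl)
  also have "\<dots> \<le> (\<Sum>i\<in>(UNIV::'t set). \<Sum>j\<in>(UNIV::'t set). norm x * Re (trace M) * norm x)"
    unfolding norm_mult complex_mod_cnj
    by (intro sum_mono mult_mono psd_entry_le_trace assms)
       (simp_all add: Finite_Cartesian_Product.norm_nth_le tr)
  finally show ?thesis by (simp add: power2_eq_square mult_ac)
qed

section \<open>Matrix algebra at a single frequency, for the pair (f, g) and the inverse G of f +
  g\<close>

locale psd_pair =
  fixes f g G :: "complex^'t^'t"
  assumes f: "herm_psd f" and g: "herm_psd g"
    and G1: "(f + g) ** G = mat 1" and G2: "G ** (f + g) = mat 1"
begin

lemma sum_psd: "herm_psd (f + g)" using f g by (rule herm_psd_add)

lemma vF [simp]: "x v* (f + g) v* G = x" "x v* G v* (f + g) = x"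
  by (simp_all add: vector_matrix_mul_assoc G1 G2)

text \<open>Write \<open>y\<close> as \<open>y v* G v* (f + g)\<close> and move the Hermitian sum to
  the other side, where it cancels against \<open>G\<close>.\<close>

lemma G_hermitian: "cdot (x v* G) y = cdot x (y v* G)"
proof -
  have "cdot (x v* G) y = cdot (x v* G) ((y v* G) v* (f + g))" by simp
  also have "\<dots> = cdot ((x v* G) v* (f + g)) (y v* G)" by (rule herm_psdD(1)[OF sum_psd, symmetric])
  finally show ?thesis by simp
qed

lemma qform_F_G: "qform (x v* G) (f + g) = qform x G"
  by (simp add: qform_eq_cdot G_hermitian)

lemma inv_psd: "herm_psd G"
  unfolding herm_psd_def
proof (intro conjI allI)
  fix i j x
  have "cdot (axis i 1 v* G) (axis j 1) = cnj (cdot (axis j 1 v* G) (axis i 1))"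
    by (simp add: cnj_cdot G_hermitian)
  then show "G $ i $ j = cnj (G $ j $ i)" by (simp add: cdot_axis axis_vector_matrix_mult)
  show "0 \<le> Re (qform x G)" using herm_psdD(2)[OF sum_psd] by (simp add: qform_F_G[symmetric])
qed

lemma qform_f_le: "Re (qform x f) \<le> Re (qform x (f + g))"
  using herm_psdD(2)[OF g] by (simp add: qform_add_matrix)

lemma qform_g_le: "Re (qform x g) \<le> Re (qform x (f + g))"
  using herm_psdD(2)[OF f] by (simp add: qform_add_matrix)

text \<open>The vector \<open>axis i 1 v* G\<close> represents the i-th coordinate in the form of
  \<open>f + g\<close>, and its own form has the value \<open>G $ i $ i\<close>. The weighted
  inequality then separates \<open>b\<close> from \<open>G\<close>, which is where minimality will
  enter.\<close>

lemma coordinate_le: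
  assumes "0 < t"
  shows "2 * cmod (b $ i) \<le> t * Re (qform b (f + g)) + Re (G $ i $ i) / t"
proof -
  have "cdot (b v* (f + g)) (axis i 1 v* G) = b $ i"
    by (simp add: G_hermitian[symmetric] cdot_axis)
  with psd_cauchy_schwarz_weighted[OF sum_psd assms, of b "axis i 1 v* G"]
  show ?thesis by (simp add: qform_F_G qform_axis)
qed

text \<open>With u = x f G, the form of f + g at u equals <xf, u>. Cauchy--Schwarz for f bounds this
  by half the f-form of x plus half the f-form of u; the latter is at most half the left side and is
  absorbed.\<close>

lemma qform_fG_le: "Re (qform (x v* f v* G) (f + g)) \<le> Re (qform x f)"
proof -
  let ?u = "x v* f v* G"
  have "qform ?u (f + g) = cdot (x v* f) ?u" by (simp add: qform_eq_cdot)
  then have "2 * Re (qform ?u (f + g)) \<le> Re (qform x f) + Re (qform ?u f)"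
    using psd_cauchy_schwarz[OF f, of x ?u] complex_Re_le_cmod[of "cdot (x v* f) ?u"] by simp
  with qform_f_le[of ?u] show ?thesis by linarith
qed

text \<open>Cauchy--Schwarz for f between the i-th unit vector and the j-th row of G, whose f-form
  is at most its (f + g)-form \<open>G $ j $ j\<close>. It makes the integrals defining
  \<open>Dmat\<close> converge.\<close>

lemma fG_entry_le: "2 * cmod ((f ** G) $ i $ j) \<le> Re (f $ i $ i) + Re (G $ j $ j)"
proof -
  have "(f ** G) $ i $ j = cdot (axis i 1 v* f) (axis j 1 v* G)"
    by (simp add: G_hermitian[symmetric] cdot_axis vector_matrix_mul_assoc axis_vector_matrix_mult)
  with psd_cauchy_schwarz[OF f, of "axis i 1" "axis j 1 v* G"] qform_f_le[of "axis j 1 v* G"]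
  show ?thesis by (simp add: qform_axis qform_F_G)
qed

text \<open>Cauchy--Schwarz for g between e_i f G and e_j; the g-form of the former is at most the
  f-form of e_i by \<open>qform_fG_le\<close>. Thus the integrand of \<open>Rmat\<close> is
  dominated by the densities themselves.\<close>

lemma fGg_entry_le: "2 * cmod ((f ** G ** g) $ i $ j) \<le> Re (f $ i $ i) + Re (g $ j $ j)"
proof -
  let ?u = "axis i 1 v* f v* G"
  have "(f ** G ** g) $ i $ j = cdot (?u v* g) (axis j 1)"
    by (simp add: cdot_axis vector_matrix_mul_assoc axis_vector_matrix_mult)
  with psd_cauchy_schwarz[OF g, of ?u "axis j 1"] qform_g_le[of ?u] qform_fG_le[of "axis i 1"]
  show ?thesis by (simp add: qform_axis)
qed

text \<open>Follows from f G (f + g) = f. The right side is visibly Hermitian and is the form in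
  which the error value appears.\<close>

lemma fGg: "f ** G ** g = f - f ** G ** f"
proof -
  have "f ** G ** f + f ** G ** g = f ** (G ** (f + g))"
    by (simp only: matrix_add_ldistrib matrix_mul_assoc)
  then show ?thesis by (simp add: G2 algebra_simps)
qed

lemma fGg_hermitian: "cnj ((f ** G ** g) $ j $ i) = (f ** G ** g) $ i $ j"
proof -
  have *: "cdot (x v* (f ** G ** g)) y = cdot x (y v* (f ** G ** g))" for x y
    unfolding fGg
    by (simp add: vector_matrix_mult_diff_rdistrib cdot_simps vector_matrix_mul_assoc[symmetric]
       herm_psdD(1)[OF f] G_hermitian)
  have "cdot (axis i 1 v* (f ** G ** g)) (axis j 1) = cnj (cdot (axis j 1 v* (f ** G ** g)) (axis i 1))"
    by (simp only: cnj_cdot *)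
  then show ?thesis by (simp add: cdot_axis axis_vector_matrix_mult)
qed

text \<open>Both expressions agree because A f G + A g G = A.\<close>

lemma estimate_eq:
  "(A v* f - C) v* G = A - (A v* g + C) v* G"
proof -
  have "A v* f v* G + A v* g v* G = A"
    by (metis vF(1) vector_matrix_left_distrib vector_matrix_mult_add_rdistrib)
  then show ?thesis
    by (simp add: vector_matrix_left_distrib vector_matrix_mult_diff_distrib algebra_simps)
qed

text \<open>Completing the square around h: the part linear in d is governed by A f - h (f + g),
  which is C by the choice of h. After integration the term with C vanishes for every admissible
  direction d.\<close>

lemma error_expand:
  fixes A C d :: "complex^'t"
  defines "h \<equiv> (A v* f - C) v* G"
  shows "Re (qform (A - (h + d)) f) + Re (qform (h + d) g)
    = Re (qform (A - h) f) + Re (qform h g) + Re (qform d (f + g)) - 2 * Re (cdot C d)"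
proof -
  have hF: "cdot (h v* f) x + cdot (h v* g) x = cdot (A v* f) x - cdot C x" for x
  proof -
    have "h v* f + h v* g = A v* f - C" 
      unfolding h_def by (metis vF(2) vector_matrix_mult_add_rdistrib)
    from arg_cong[OF this, of "\<lambda>v. cdot v x"] show ?thesis by (simp add: cdot_simps)
  qed
  have sym: "Re (cdot (d v* M) x) = Re (cdot (x v* M) d)" if "herm_psd M" for M and x :: "complex^'t"
    using arg_cong[OF cnj_cdot[of "d v* M" x], of Re] by (simp add: herm_psdD(1)[OF that])
  have e1: "Re (qform (A - (h + d)) f) = Re (qform (A - h) f) + Re (qform d f)
     - 2 * Re (cdot (A v* f) d) + 2 * Re (cdot (h v* f) d)"
    using sym[OF f, of A] sym[OF f, of h]
    by (simp add: qform_eq_cdot vector_matrix_left_distrib vector_matrix_mult_diff_distrib cdot_simps)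
  have e2: "Re (qform (h + d) g) = Re (qform h g) + Re (qform d g) + 2 * Re (cdot (h v* g) d)"
    using sym[OF g, of h]
    by (simp add: qform_eq_cdot vector_matrix_left_distrib cdot_simps)
  have "Re (cdot (h v* f) d) + Re (cdot (h v* g) d) = Re (cdot (A v* f) d) - Re (cdot C d)"
    using arg_cong[OF hF[of d], of Re] by simp
  with e1 e2 show ?thesis by (simp add: qform_add_matrix)
qed

lemma error_value:
  fixes A C :: "complex^'t"
  defines "h \<equiv> (A v* f - C) v* G"
  shows "qform (A - h) f + qform h g = qform A (f ** G ** g) + qform C G"
proof -
  have hF: "h v* f + h v* g = A v* f - C"
    unfolding h_def by (metis vF(2) vector_matrix_mult_add_rdistrib)
  have "qform (A - h) f + qform h g = cdot (A v* f) A - cdot (A v* f) h - cdot (h v* f) A + cdot (h v* f + h v* g) h"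
    by (simp add: qform_eq_cdot vector_matrix_mult_diff_distrib cdot_simps)
  \<comment> \<open>Since h (f + g) = A f - C, the last term cancels -<Af, h> and leaves -<C,
    h>.\<close>
  also have "\<dots> = cdot (A v* f) A - cdot (h v* f) A - cdot C h"
    by (simp add: hF cdot_simps)
  \<comment> \<open>Inserting h = (A f - C) G, the mixed terms <CGf, A> and <C, AfG> coincide and
    cancel, because f and G are Hermitian.\<close>
  also have "\<dots> = qform A (f ** G ** g) + qform C G"
    unfolding fGg h_def
    by (simp add: qform_eq_cdot vector_matrix_mult_diff_rdistrib vector_matrix_mult_diff_distrib
       cdot_simps vector_matrix_mul_assoc[symmetric] herm_psdD(1)[OF f] G_hermitian)
  finally show ?thesis .
qed

end

section \<open>Inverse matrices and measurability\<close>

text \<open>Gaussian elimination, removing one equation and one unknown at a time. The coefficients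
  are functions on index sets, as the matrices indexed by \<open>S \<times> UNIV\<close>
  are.\<close>

lemma underdetermined_system:
  fixes M :: "'i \<Rightarrow> 'j \<Rightarrow> 'a::field"
  assumes "finite I" "finite J" "card I < card J"
  shows "\<exists>x. (\<exists>j\<in>J. x j \<noteq> 0) \<and> (\<forall>i\<in>I. (\<Sum>j\<in>J. M i j * x j) = 0)"
  using assms
proof (induction I arbitrary: J M rule: finite_induct)
  case empty
  then have "J \<noteq> {}" by auto
  then show ?case by (intro exI[of _ "\<lambda>_. 1"]) auto
next
  case (insert p I)
  show ?case
  proof (cases "\<forall>j\<in>J. M p j = 0")
    case True
    have "card I < card J" using insert by simp
    from insert.IH[OF insert.prems(1) this, of M] obtain x
      where "\<exists>j\<in>J. x j \<noteq> 0" "\<forall>i\<in>I. (\<Sum>j\<in>J. M i j * x j) = 0" by blast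
    with True show ?thesis by (intro exI[of _ x]) simp
  next
    case False
    then obtain r where r: "r \<in> J" "M p r \<noteq> 0" by blast
    let ?J = "J - {r}"
    have "card I < card ?J" "finite ?J" using insert r by simp_all
    \<comment> \<open>Equation \<open>p\<close> is used to eliminate the unknown \<open>r\<close>,
      its coefficient \<open>M p r\<close> being the pivot.\<close>
    from insert.IH[OF this(2,1), of "\<lambda>i j. M i j - M i r * M p j / M p r"]
    obtain x where x: "\<exists>j\<in>?J. x j \<noteq> 0"
      "\<forall>i\<in>I. (\<Sum>j\<in>?J. (M i j - M i r * M p j / M p r) * x j) = 0" by blast
    define t where "t = (\<Sum>j\<in>?J. M p j * x j)"
    \<comment> \<open>Back substitution: the value at \<open>r\<close> is the one forced by equation
      \<open>p\<close>.\<close>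
    define y where "y = x(r := - t / M p r)"
    have split: "(\<Sum>j\<in>J. M i j * y j) = M i r * (- t / M p r) + (\<Sum>j\<in>?J. M i j * x j)" for i
    proof -
      have "(\<Sum>j\<in>?J. M i j * y j) = (\<Sum>j\<in>?J. M i j * x j)"
        by (rule sum.cong) (auto simp: y_def)
      then show ?thesis using sum.remove[OF insert.prems(1) r(1), of "\<lambda>j. M i j * y j"]
        by (simp add: y_def)
    qed
    have "(\<Sum>j\<in>J. M i j * y j) = 0" if "i \<in> I" for i
    proof -
      have "(\<Sum>j\<in>?J. (M i j - M i r * M p j / M p r) * x j)
        = (\<Sum>j\<in>?J. M i j * x j) - M i r / M p r * t"
        unfolding t_def sum_distrib_left sum_subtractf[symmetric]
        by (rule sum.cong) (auto simp: algebra_simps)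
      with x(2) that show ?thesis by (simp add: split)
    qed
    moreover have "(\<Sum>j\<in>J. M p j * y j) = 0" using r by (simp add: split t_def)
    moreover have "\<exists>j\<in>J. y j \<noteq> 0" using x(1) by (auto simp: y_def)
    ultimately show ?thesis by blast
  qed
qed

text \<open>A trivial kernel first yields a right inverse column by column, by a dimension count;
  the kernel condition then shows that it is a left inverse as well.\<close>

lemma invertible_onI:
  assumes fin: "finite I"
    and ker: "\<And>x. \<forall>p\<in>I. mvec I M x p = 0 \<Longrightarrow> \<forall>p\<in>I. x p = 0"
  shows "invertible_on I M"
proof -
  have "\<exists>y. \<forall>p\<in>I. mvec I M y p = (if p = q then 1 else 0)" for q
  proof -
    \<comment> \<open>The unknown \<open>None\<close> is the coefficient of the right-hand side, so
      there is one more unknown than equations. A nonzero solution cannot have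
      \<open>x None = 0\<close>, as the rest would lie in the kernel; dividing by it solves the
      inhomogeneous system.\<close>
    let ?J = "insert None (Some ` I)"
    let ?M = "\<lambda>p j. case j of None \<Rightarrow> (if p = q then 1 else 0) | Some r \<Rightarrow> M p r"
    have "card I < card ?J" using fin by (simp add: card_image)
    from underdetermined_system[OF fin _ this, of ?M] fin obtain x where
      x: "\<exists>j\<in>?J. x j \<noteq> 0" and "\<forall>i\<in>I. (\<Sum>j\<in>?J. ?M i j * x j) = 0" by auto
    then have 0: "\<forall>i\<in>I. (if i = q then 1 else 0) * x None + mvec I M (\<lambda>r. x (Some r)) i = 0"
      using fin by (simp add: sum.reindex mvec_def)
    have nz: "x None \<noteq> 0"
    proof
      assume "x None = 0"
      with 0 ker[of "\<lambda>r. x (Some r)"] x show False by auto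
    qed
    show ?thesis
    proof (intro exI[of _ "\<lambda>r. - x (Some r) / x None"] ballI)
      fix p assume "p \<in> I"
      have "mvec I M (\<lambda>r. - x (Some r) / x None) p = - mvec I M (\<lambda>r. x (Some r)) p / x None"
        by (simp add: mvec_def sum_negf sum_divide_distrib)
      with 0 \<open>p \<in> I\<close> nz show "mvec I M (\<lambda>r. - x (Some r) / x None) p = (if p = q then 1 else 0)"
        by (auto simp: add_eq_0_iff)
    qed
  qed
  then obtain Y where Y: "\<And>q p. p \<in> I \<Longrightarrow> mvec I M (Y q) p = (if p = q then 1 else 0)" by metis
  have "is_inv_on I M (\<lambda>p q. Y q p)"
    unfolding is_inv_on_def
  proof (intro conjI ballI)
    fix p q assume "p \<in> I" "q \<in> I"
    then show "(\<Sum>r\<in>I. M p r * Y q r) = (if p = q then 1 else 0)"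
      using Y[of p q] by (simp add: mvec_def)
    \<comment> \<open>\<open>z\<close> is column \<open>q\<close> of N M - 1 for the right inverse
      N. It lies in the kernel, because M (N M - 1) = (M N - 1) M = 0.\<close>
    define z where "z p = (\<Sum>r\<in>I. Y r p * M r q) - (if p = q then 1 else 0)" for p
    have "mvec I M z i = 0" if "i \<in> I" for i
    proof -
      have "mvec I M z i = (\<Sum>p\<in>I. \<Sum>r\<in>I. M i p * Y r p * M r q) - (\<Sum>p\<in>I. M i p * (if p = q then 1 else 0))"
        by (simp add: mvec_def z_def right_diff_distrib sum_subtractf sum_distrib_left mult.assoc)
      also have "(\<Sum>p\<in>I. \<Sum>r\<in>I. M i p * Y r p * M r q) = (\<Sum>r\<in>I. mvec I M (Y r) i * M r q)"
        unfolding mvec_def sum_distrib_right by (rule sum.swap)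
      also have "\<dots> = (\<Sum>r\<in>I. if r = i then M i q else 0)"
        by (rule sum.cong) (auto simp: Y that)
      finally show ?thesis using fin that \<open>q \<in> I\<close> by (simp add: if_distrib cong: if_cong)
    qed
    with ker[of z] \<open>p \<in> I\<close> show "(\<Sum>r\<in>I. Y r p * M r q) = (if p = q then 1 else 0)"
      by (auto simp: z_def)
  qed
  then show ?thesis unfolding invertible_on_def by blast
qed

section \<open>Measurability of matrix expressions, including the inverse\<close>

lemma borel_measurable_vec_nth:
  fixes b :: "'a \<Rightarrow> complex^'t"
  assumes "b \<in> borel_measurable M" shows "(\<lambda>x. b x $ i) \<in> borel_measurable M"
proof -
  have "(\<lambda>v::complex^'t. v $ i) \<in> borel_measurable borel"
    by (intro borel_measurable_continuous_onI continuous_intros)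
  from measurable_compose[OF assms this] show ?thesis .
qed

lemma borel_measurable_vecI:
  fixes b :: "'a \<Rightarrow> complex^'t"
  assumes "\<And>i. (\<lambda>x. b x $ i) \<in> borel_measurable M" shows "b \<in> borel_measurable M"
proof (subst borel_measurable_euclidean_space, intro ballI)
  fix u :: "complex^'t" assume "u \<in> Basis"
  then obtain i v where "u = axis i v" by (auto simp: Basis_vec_def)
  then show "(\<lambda>x. b x \<bullet> u) \<in> borel_measurable M"
    using assms[of i] by (simp add: inner_axis)
qed

lemma borel_measurable_matrix_mult:
  fixes P Q :: "'a \<Rightarrow> complex^'t^'t"
  assumes "\<And>i j. (\<lambda>x. P x $ i $ j) \<in> borel_measurable M" "\<And>i j. (\<lambda>x. Q x $ i $ j) \<in> borel_measurable M"
  shows "(\<lambda>x. (P x ** Q x) $ i $ j) \<in> borel_measurable M"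
  using assms by (simp add: matrix_matrix_mult_def)

lemma borel_measurable_vector_matrix_mult:
  fixes P :: "'a \<Rightarrow> complex^'t^'t"
  assumes "b \<in> borel_measurable M" "\<And>i j. (\<lambda>x. P x $ i $ j) \<in> borel_measurable M"
  shows "(\<lambda>x. b x v* P x) \<in> borel_measurable M"
  using assms(2) borel_measurable_vec_nth[OF assms(1)]
  by (intro borel_measurable_vecI) (simp add: vector_matrix_mult_def)

lemma borel_measurable_cdot:
  assumes "b \<in> borel_measurable M" "d \<in> borel_measurable M"
  shows "(\<lambda>x. cdot (b x) (d x)) \<in> borel_measurable M"
  unfolding cdot_def
  by (intro borel_measurable_sum borel_measurable_times borel_measurable_vec_nth assms
      measurable_compose[OF borel_measurable_vec_nth[OF assms(2)], of cnj] 
      borel_measurable_continuous_onI continuous_intros)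

lemma borel_measurable_qform:
  fixes P :: "'a \<Rightarrow> complex^'t^'t"
  assumes "b \<in> borel_measurable M" "\<And>i j. (\<lambda>x. P x $ i $ j) \<in> borel_measurable M"
  shows "(\<lambda>x. qform (b x) (P x)) \<in> borel_measurable M"
  unfolding qform_eq_cdot
  by (intro borel_measurable_cdot borel_measurable_vector_matrix_mult assms)

text \<open>On singular matrices \<open>matrix_inv\<close> is a fixed junk value, so it is measurable everywhere.\<close>

lemma matrix_inv_entry:
  fixes A :: "complex^'t^'t"
  shows "matrix_inv A $ k $ j = (if det A = 0 then (SOME X::complex^'t^'t. False) $ k $ j
     else det (\<chi> i l. if l = k then axis j 1 $ i else A $ i $ l) / det A)"
proof (cases "det A = 0")
  case True
  then have "\<not> invertible A" by (simp add: invertible_det_nz)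
  then have "matrix_inv A = (SOME X. False)"
    unfolding matrix_inv_def invertible_def by (metis (no_types))
  then show ?thesis using True by simp
next
  case False
  then have "invertible A" by (simp add: invertible_det_nz)
  then have "A ** matrix_inv A = mat 1"
    unfolding invertible_def matrix_inv_def by (rule someI_ex[THEN conjunct1])
  \<comment> \<open>Column \<open>j\<close> of the inverse solves a linear system, so Cramer's rule
    writes its entries as quotients of determinants, which depend measurably on the entries of
    \<open>A\<close>.\<close>
  then have "A *v (matrix_inv A *v axis j 1) = axis j 1"
    by (simp add: matrix_vector_mul_assoc)
  note arg_cong[OF iffD1[OF cramer[OF False] this], of "\<lambda>v. v $ k"]
  moreover have "(matrix_inv A *v axis j 1) $ k = matrix_inv A $ k $ j"
    by (simp add: matrix_vector_mult_def axis_def if_distrib cong: if_cong)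
  ultimately show ?thesis using False by simp
qed

lemma borel_measurable_det:
  fixes A :: "'a \<Rightarrow> complex^'t^'t"
  assumes "\<And>i j. (\<lambda>x. A x $ i $ j) \<in> borel_measurable M"
  shows "(\<lambda>x. det (A x)) \<in> borel_measurable M"
  unfolding det_def by (intro borel_measurable_sum borel_measurable_times borel_measurable_prod assms borel_measurable_const)

lemma borel_measurable_matrix_inv:
  fixes A :: "'a \<Rightarrow> complex^'t^'t"
  assumes "\<And>i j. (\<lambda>x. A x $ i $ j) \<in> borel_measurable M"
  shows "(\<lambda>x. matrix_inv (A x) $ i $ j) \<in> borel_measurable M"
proof -
  have [measurable]: "(\<lambda>x. det (A x)) \<in> borel_measurable M"
    by (rule borel_measurable_det[OF assms])
  have [measurable]: "(\<lambda>x. det (\<chi> k l. if l = i then axis j 1 $ k else A x $ k $ l)) \<in> borel_measurable M"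
  proof (rule borel_measurable_det)
    fix k l
    show "(\<lambda>x. (\<chi> k l. if l = i then axis j 1 $ k else A x $ k $ l) $ k $ l) \<in> borel_measurable M"
      by (cases "l = i") (simp_all add: assms)
  qed
  show ?thesis unfolding matrix_inv_entry by measurable
qed

section \<open>Trigonometric polynomials\<close>

abbreviation circ :: "real measure" where
  "circ \<equiv> restrict_space lborel {-pi..pi}"

definition fexp :: "int \<Rightarrow> real \<Rightarrow> complex" where
  "fexp k l = exp (\<i> * of_int k * of_real l)"

lemma set_integrable_circ:
  fixes \<phi> :: "real \<Rightarrow> 'b::{banach, second_countable_topology}"
  shows "set_integrable lborel {-pi..pi} \<phi> \<longleftrightarrow> integrable circ \<phi>"
  by (simp add: set_integrable_def integrable_restrict_space)

lemma set_integral_circ: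
  fixes \<phi> :: "real \<Rightarrow> 'b::{banach, second_countable_topology}"
  shows "(LINT l:{-pi..pi}|lborel. \<phi> l) = integral\<^sup>L circ \<phi>"
  by (simp add: set_lebesgue_integral_def integral_restrict_space)

lemma AE_circ: "(AE l in lborel. l \<in> {-pi..pi} \<longrightarrow> P l) \<longleftrightarrow> (AE l in circ. P l)"
  by (simp add: AE_restrict_space_iff)

lemma finite_measure_circ: "finite_measure circ"
  by (rule finite_measureI) (simp add: emeasure_restrict_space space_restrict_space)

lemma measurable_circ: "\<phi> \<in> borel_measurable lborel \<Longrightarrow> \<phi> \<in> borel_measurable circ"
  by (rule measurable_restrict_space1)

lemma AE_circ_interior: "AE l in circ. -pi < l \<and> l < pi"
proof -
  have "AE l in lborel. l \<noteq> pi" "AE l in lborel. l \<noteq> -pi" by (rule AE_lborel_singleton)+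
  then have "AE l in lborel. l \<in> {-pi..pi} \<longrightarrow> -pi < l \<and> l < pi"
    by eventually_elim auto
  then show ?thesis by (simp only: AE_circ)
qed

lemma fexp_measurable [measurable]: "fexp k \<in> borel_measurable borel"
  unfolding fexp_def by (intro borel_measurable_continuous_onI continuous_intros)

lemma fexp_measurable_circ: "fexp k \<in> borel_measurable circ"
  by (rule measurable_circ) simp

lemma fexp_add: "fexp j l * fexp k l = fexp (j + k) l"
  by (simp add: fexp_def exp_add[symmetric] algebra_simps)

lemma cnj_fexp: "cnj (fexp k l) = fexp (- k) l"
  by (simp add: fexp_def exp_cnj)

lemma norm_fexp [simp]: "cmod (fexp k l) = 1"
  by (simp add: fexp_def norm_exp_eq_Re)

lemma integrable_circ_mult_fexp:
  assumes "integrable circ \<phi>"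
  shows "integrable circ (\<lambda>l. \<phi> l * fexp k l)"
  by (rule Bochner_Integration.integrable_bound[OF assms])
     (use fexp_measurable_circ[of k] borel_measurable_integrable[OF assms] in \<open>auto simp: norm_mult\<close>)

lemma integrable_fexp: "integrable circ (fexp k)"
proof -
  interpret finite_measure circ by (rule finite_measure_circ)
  show ?thesis by (rule integrable_const_bound[of _ 1]) (auto simp: fexp_measurable_circ)
qed

lemma integral_fexp: "integral\<^sup>L circ (fexp k) = (if k = 0 then of_real (2 * pi) else 0)"
proof (cases "k = 0")
  case True
  then have "fexp k = (\<lambda>_. 1)" by (simp add: fexp_def fun_eq_iff)
  with True show ?thesis
    by (simp add: measure_restrict_space space_restrict_space scaleR_conv_of_real)
next
  case False
  let ?E = "\<lambda>l. fexp k l / (\<i> * of_int k)"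
  have "integral\<^sup>L circ (fexp k) = ?E pi - ?E (-pi)"
    unfolding set_integral_circ[symmetric] set_lebesgue_integral_def
  proof (rule integral_FTC_atLeastAtMost)
    fix l :: real
    have "((\<lambda>z. exp (\<i> * of_int k * z) / (\<i> * of_int k)) has_field_derivative exp (\<i> * of_int k * of_real l)) (at (of_real l))"
      using False by (auto intro!: derivative_eq_intros)
    from has_vector_derivative_real_field[OF this]
    show "(?E has_vector_derivative fexp k l) (at l within {-pi..pi})"
      by (simp add: fexp_def has_vector_derivative_at_within)
  qed (auto simp: fexp_def intro!: continuous_intros)
  also have "fexp k pi = fexp k (-pi)"
  proof -
    have "fexp k pi = fexp k (-pi) * exp (2 * of_int k * pi * \<i>)"
      unfolding fexp_def exp_add[symmetric] by (rule arg_cong[of _ _ exp]) (simp add: algebra_simps)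
    also have "exp (2 * of_int k * pi * \<i>) = 1" by (rule exp_integer_2pi) simp
    finally show ?thesis by simp
  qed
  finally show ?thesis using False by simp
qed

definition trig_poly :: "(real \<Rightarrow> complex) \<Rightarrow> bool" where
  "trig_poly \<phi> \<longleftrightarrow> (\<exists>E w. finite E \<and> \<phi> = (\<lambda>l. \<Sum>k\<in>E. w k * fexp k l))"

lemma trig_poly_fexp: "trig_poly (\<lambda>l. c * fexp k l)"
  unfolding trig_poly_def by (intro exI[of _ "{k}"] exI[of _ "\<lambda>_. c"]) simp

lemma trig_poly_const: "trig_poly (\<lambda>l. c)"
  using trig_poly_fexp[of c 0] by (simp add: fexp_def)

lemma trig_poly_add:
  assumes "trig_poly \<phi>" "trig_poly \<psi>" shows "trig_poly (\<lambda>l. \<phi> l + \<psi> l)"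
proof -
  obtain E w D v where E: "finite E" "\<phi> = (\<lambda>l. \<Sum>k\<in>E. w k * fexp k l)"
    and D: "finite D" "\<psi> = (\<lambda>l. \<Sum>k\<in>D. v k * fexp k l)"
    using assms unfolding trig_poly_def by blast
  let ?w = "\<lambda>k. if k \<in> E then w k else 0" and ?v = "\<lambda>k. if k \<in> D then v k else 0"
  have "\<phi> l = (\<Sum>k\<in>E \<union> D. ?w k * fexp k l)" for l
    unfolding E(2) by (rule sum.mono_neutral_cong_left) (use E D in auto)
  moreover have "\<psi> l = (\<Sum>k\<in>E \<union> D. ?v k * fexp k l)" for l
    unfolding D(2) by (rule sum.mono_neutral_cong_left) (use E D in auto)
  ultimately have "(\<lambda>l. \<phi> l + \<psi> l) = (\<lambda>l. \<Sum>k\<in>E \<union> D. (?w k + ?v k) * fexp k l)"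
    by (simp add: distrib_right sum.distrib del: if_split)
  with E(1) D(1) show ?thesis
    unfolding trig_poly_def by (intro exI[of _ "E \<union> D"] exI[of _ "\<lambda>k. ?w k + ?v k"]) simp
qed

lemma trig_poly_sum:
  assumes "\<And>i. i \<in> J \<Longrightarrow> trig_poly (\<phi> i)"
  shows "trig_poly (\<lambda>l. \<Sum>i\<in>J. \<phi> i l)"
  using assms by (induction J rule: infinite_finite_induct) (auto intro: trig_poly_add trig_poly_const)

lemma trig_poly_mult:
  assumes "trig_poly \<phi>" "trig_poly \<psi>" shows "trig_poly (\<lambda>l. \<phi> l * \<psi> l)"
proof -
  obtain E w D v where E: "finite E" "\<phi> = (\<lambda>l. \<Sum>k\<in>E. w k * fexp k l)"
    and D: "finite D" "\<psi> = (\<lambda>l. \<Sum>k\<in>D. v k * fexp k l)"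
    using assms unfolding trig_poly_def by blast
  have "(\<lambda>l. \<phi> l * \<psi> l) = (\<lambda>l. \<Sum>k\<in>E. \<Sum>j\<in>D. (w k * v j) * fexp (k + j) l)"
    unfolding E(2) D(2) sum_product fexp_add[symmetric] by (simp add: mult_ac)
  then show ?thesis by (simp only:) (intro trig_poly_sum trig_poly_fexp)
qed

text \<open>Translates the polynomials of Stone--Weierstrass, taken in the real and imaginary part,
  into exponentials. A linear \<open>r\<close> on the circle is r(1) cos + r(i) sin, and
  trigonometric polynomials are closed under sums and products.\<close>

lemma trig_poly_real_polynomial:
  assumes "real_polynomial_function (r :: complex \<Rightarrow> real)"
  shows "trig_poly (\<lambda>l. of_real (r (cis l)))"
  using assms
proof induction
  case (linear r)
  then interpret bounded_linear r .
  have "r (cis l) = cos l * r 1 + sin l * r \<i>" for l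
  proof -
    have "cis l = cos l *\<^sub>R 1 + sin l *\<^sub>R \<i>" by (simp add: complex_eq_iff)
    then show ?thesis by (simp add: add scaleR)
  qed
  moreover have "complex_of_real (cos l) = 1/2 * fexp 1 l + 1/2 * fexp (-1) l" for l
    by (simp add: fexp_def cos_of_real[symmetric] cos_exp_eq)
  moreover have "complex_of_real (sin l) = (1/(2*\<i>)) * fexp 1 l + (-1/(2*\<i>)) * fexp (-1) l" for l
    by (simp add: fexp_def sin_of_real[symmetric] sin_exp_eq field_simps)
  ultimately have "(\<lambda>l. complex_of_real (r (cis l))) = (\<lambda>l. (1/2 * fexp 1 l + 1/2 * fexp (-1) l) * of_real (r 1)
     + ((1/(2*\<i>)) * fexp 1 l + (-1/(2*\<i>)) * fexp (-1) l) * of_real (r \<i>))"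
    by (simp only: of_real_add of_real_mult)
  then show ?case
    by (simp only:) (rule trig_poly_add trig_poly_mult[OF _ trig_poly_const] trig_poly_fexp)+
next
  case (const c)
  show ?case by (rule trig_poly_const)
next
  case (add r q)
  from add.IH show ?case unfolding of_real_add by (rule trig_poly_add)
next
  case (mult r q)
  from mult.IH show ?case unfolding of_real_mult by (rule trig_poly_mult)
qed

text \<open>With no frequency excluded, \<open>gen_span {}\<close> is the space of all vector
  trigonometric polynomials.\<close>

lemma gen_span_emptyI:
  fixes p :: "real \<Rightarrow> complex^'t"
  assumes "\<And>i. trig_poly (\<lambda>l. p l $ i)"
  shows "p \<in> gen_span {}"
proof -
  have "\<forall>i. \<exists>E w. finite E \<and> (\<lambda>l. p l $ i) = (\<lambda>l. \<Sum>k\<in>E. w k * fexp k l)"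
    using assms unfolding trig_poly_def by (rule allI)
  then obtain E where "\<forall>i. \<exists>w. finite (E i) \<and> (\<lambda>l. p l $ i) = (\<lambda>l. \<Sum>k\<in>E i. w k * fexp k l)"
    by (rule choice[THEN exE])
  then obtain w where "\<forall>i. finite (E i) \<and> (\<lambda>l. p l $ i) = (\<lambda>l. \<Sum>k\<in>E i. w i k * fexp k l)"
    by (rule choice[THEN exE])
  then have E: "\<And>i. finite (E i)" and w: "\<And>i. (\<lambda>l. p l $ i) = (\<lambda>l. \<Sum>k\<in>E i. w i k * fexp k l)"
    by simp_all
  \<comment> \<open>The coordinates may use different frequency sets; they are merged into one, and
    missing coefficients are padded with zero.\<close>
  define D where "D = (\<Union>i. E i)"
  define v where "v = (\<lambda>q. if fst q \<in> E (snd q) then w (snd q) (fst q) else 0)"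
  have fD: "finite D" unfolding D_def using E by simp
  have "p l $ i = (\<Sum>q\<in>D \<times> UNIV. v q *s (fexp (fst q) l *s axis (snd q) 1)) $ i" for l i
  proof -
    have "p l $ i = (\<Sum>k\<in>D. v (k, i) * fexp k l)"
      unfolding fun_cong[OF w]
      by (rule sum.mono_neutral_cong_left) (use fD in \<open>auto simp: D_def v_def\<close>)
    also have "\<dots> = (\<Sum>k\<in>D. \<Sum>j\<in>UNIV. v (k, j) * (fexp k l * axis j 1 $ i))"
      by (simp add: axis_def if_distrib cong: if_cong)
    also have "\<dots> = (\<Sum>q\<in>D \<times> UNIV. v q *s (fexp (fst q) l *s axis (snd q) 1)) $ i"
      by (simp add: sum.cartesian_product split_beta mult.assoc)
    finally show ?thesis .
  qed
  then have "p = (\<lambda>l. \<Sum>q\<in>D \<times> UNIV. v q *s (fexp (fst q) l *s axis (snd q) 1))"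
    by (simp add: vec_eq_iff fun_eq_iff)
  then show ?thesis unfolding gen_span_def mem_Collect_eq fexp_def[symmetric] using fD
    by (intro exI[of _ "D \<times> UNIV"] exI[of _ v]) simp
qed

lemma trig_approx_continuous:
  fixes H :: "complex \<Rightarrow> complex^'t"
  assumes "continuous_on (sphere 0 1) H" "0 < e"
  shows "\<exists>p\<in>gen_span {}. \<forall>l. norm (H (cis l) - p l) < e"
proof -
  obtain q where q: "polynomial_function q" "\<forall>x\<in>sphere 0 1. norm (H x - q x) < e"
    using Stone_Weierstrass_polynomial_function[OF compact_sphere assms] by blast
  have "trig_poly (\<lambda>l. q (cis l) $ i)" for i
  proof -
    have "bounded_linear (\<lambda>v::complex^'t. Re (v $ i))" "bounded_linear (\<lambda>v::complex^'t. Im (v $ i))"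
      by (auto intro: bounded_linear_compose[OF bounded_linear_Re] bounded_linear_compose[OF bounded_linear_Im])
    with q(1) have "real_polynomial_function ((\<lambda>v. Re (v $ i)) \<circ> q)" "real_polynomial_function ((\<lambda>v. Im (v $ i)) \<circ> q)"
      unfolding polynomial_function_def by blast+
    from this[THEN trig_poly_real_polynomial]
    have "trig_poly (\<lambda>l. of_real (Re (q (cis l) $ i)) + \<i> * of_real (Im (q (cis l) $ i)))"
      by (simp add: trig_poly_add trig_poly_mult trig_poly_const)
    then show ?thesis by (simp add: complex_eq[symmetric])
  qed
  then have "(\<lambda>l. q (cis l)) \<in> gen_span {}" by (rule gen_span_emptyI)
  with q(2) show ?thesis by (intro bexI[of _ "\<lambda>l. q (cis l)"]) (simp_all add: dist_norm)
qed

text \<open>The bound and the a.e. convergence together are what dominated convergence against an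
  integrable density needs. The continuous approximants are kept within \<open>K\<close>, and the
  uniform error of at most 1 accounts for \<open>K + 1\<close>.\<close>

lemma trig_approx_bounded:
  fixes b :: "real \<Rightarrow> complex^'t"
  assumes b: "b \<in> borel_measurable lborel" and K: "\<And>l. norm (b l) \<le> K"
  shows "\<exists>p. (\<forall>n. p n \<in> gen_span {}) \<and> (\<forall>n l. norm (p n l) \<le> K + 1)
     \<and> (AE l in circ. (\<lambda>n. p n l) \<longlonglongrightarrow> b l)"
proof -
  have K0: "0 \<le> K" using K[of 0] norm_ge_zero order_trans by blast
  have "b \<in> borel_measurable lebesgue" using b by (rule measurable_completion)
  \<comment> \<open>This yields continuous functions on the line converging to \<open>b\<close> off
    a negligible set, but neither bounded nor periodic; projection onto a ball and a cut-off repair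
    both.\<close>
  then have "b measurable_on UNIV"
    by (simp add: lebesgue_measurable_imp_measurable_on)
  then obtain N g where N: "negligible N" and g: "\<And>n. continuous_on UNIV (g n)"
    and lim: "\<And>x. x \<notin> N \<Longrightarrow> (\<lambda>n. g n x) \<longlonglongrightarrow> b x"
    unfolding measurable_on_def by auto
  \<comment> \<open>The cut-off vanishes near \<open>-1\<close>, where \<open>Arg\<close> is discontinuous.\<close>
  define cut where "cut n z = max 0 (min 1 (real n * (1 + Re z) - 1))" for n z
  \<comment> \<open>The projection onto the ball of radius \<open>K\<close> is continuous and fixes
    every value of \<open>b\<close>, so it bounds the approximants without changing their
    limit.\<close>
  define cl where "cl = closest_point (cball (0::complex^'t) K)"
  have cl: "continuous_on UNIV cl"
    unfolding cl_def using K0 by (intro continuous_on_closest_point) auto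
  have cl_le: "norm (cl v) \<le> K" for v
    using closest_point_in_set[of "cball 0 K" v] K0 by (simp add: cl_def)
  define H where "H n z = cut n z *\<^sub>R cl (g n (Arg z))" for n z
  have H: "continuous_on (sphere 0 1) (H n)" for n
  proof -
    \<comment> \<open>On \<open>?U\<close> the cut-off is zero. On \<open>?V\<close> one has Re z >
      -1, hence z is not the only nonpositive real number -1 of the circle, and \<open>Arg\<close>
      is continuous there.\<close>
    let ?U = "sphere 0 1 \<inter> {z. real n * (1 + Re z) - 1 \<le> 0}"
    let ?V = "sphere 0 1 \<inter> {z. real n * (1 + Re z) - 1 \<ge> 0}"
    have "closed ?U" "closed ?V"
      by (intro closed_Int closed_sphere closed_Collect_le continuous_intros)+
    moreover have "continuous_on ?U (H n)"
      by (rule continuous_on_eq[of _ "\<lambda>_. 0"]) (auto simp: H_def cut_def)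
    moreover have "continuous_on ?V (H n)"
    proof -
      have "z \<notin> \<real>\<^sub>\<le>\<^sub>0" if "z \<in> ?V" for z
      proof
        assume "z \<in> \<real>\<^sub>\<le>\<^sub>0"
        then obtain x where "z = of_real x" "x \<le> 0" by (auto elim: nonpos_Reals_cases)
        with that show False by auto
      qed
      then have "continuous_on ?V (\<lambda>z. g n (Arg z))"
        by (intro continuous_on_compose2[OF g] continuous_on_Arg' continuous_on_id) auto
      then have "continuous_on ?V (\<lambda>z. cl (g n (Arg z)))"
        by (rule continuous_on_compose2[OF cl]) auto
      then show ?thesis unfolding H_def cut_def by (intro continuous_intros)
    qed
    ultimately have "continuous_on (?U \<union> ?V) (H n)" by (rule continuous_on_closed_Un)
    moreover have "?U \<union> ?V = sphere 0 1" by auto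
    ultimately show ?thesis by simp
  qed
  have "\<forall>n. \<exists>p\<in>gen_span {}. \<forall>l. norm (H n (cis l) - p l) < 1 / (real n + 1)"
    using trig_approx_continuous[OF H] by simp
  then obtain p where p: "\<And>n. p n \<in> gen_span {}" and pH: "\<And>n l. norm (H n (cis l) - p n l) < 1 / (real n + 1)"
    by metis
  have bound: "norm (p n l) \<le> K + 1" for n l
  proof -
    have "norm (H n (cis l)) \<le> 1 * K"
      unfolding H_def norm_scaleR by (intro mult_mono cl_le) (auto simp: cut_def)
    moreover have "norm (p n l) \<le> norm (H n (cis l)) + norm (H n (cis l) - p n l)"
      using norm_triangle_ineq4[of "H n (cis l)" "H n (cis l) - p n l"] by simp
    moreover have "1 / (real n + 1) \<le> 1" by simp
    ultimately show ?thesis using pH[of n l] by linarith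
  qed
  have conv: "(\<lambda>n. p n l) \<longlonglongrightarrow> b l" if l: "l \<notin> N" "-pi < l" "l < pi" for l
  proof -
    \<comment> \<open>Away from the endpoints the point \<open>cis l\<close> differs from -1, so
      \<open>real n * (1 + cos l)\<close> eventually exceeds 2 and the cut-off becomes 1.\<close>
    have cos: "0 < 1 + cos l"
    proof -
      have "cos pi < cos \<bar>l\<bar>" using l by (intro cos_monotone_0_pi) auto
      then show ?thesis by simp
    qed
    have "filterlim (\<lambda>n. (1 + cos l) * real n) at_top sequentially"
      by (rule filterlim_tendsto_pos_mult_at_top[OF tendsto_const cos filterlim_real_sequentially])
    then have "eventually (\<lambda>n. 2 \<le> (1 + cos l) * real n) sequentially"
      by (simp add: filterlim_at_top)
    then have "eventually (\<lambda>n. cut n (cis l) = 1) sequentially"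
      by eventually_elim (simp add: cut_def mult.commute)
    then have "(\<lambda>n. cut n (cis l)) \<longlonglongrightarrow> 1" by (rule tendsto_eventually)
    moreover have "(\<lambda>n. cl (g n l)) \<longlonglongrightarrow> cl (b l)"
      using cl lim[OF l(1)] by (rule continuous_on_tendsto_compose) auto
    moreover have "cl (b l) = b l" unfolding cl_def by (rule closest_point_self) (use K in simp)
    ultimately have "(\<lambda>n. cut n (cis l) *\<^sub>R cl (g n l)) \<longlonglongrightarrow> 1 *\<^sub>R b l"
      by (metis tendsto_scaleR)
    moreover have "Arg (cis l) = l" using l by (simp add: Arg_cis)
    ultimately have "(\<lambda>n. H n (cis l)) \<longlonglongrightarrow> b l" by (simp add: H_def)
    moreover have "(\<lambda>n. H n (cis l) - p n l) \<longlonglongrightarrow> 0"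
      by (rule Lim_null_comparison[OF _ LIMSEQ_inverse_real_of_nat])
         (use pH in \<open>auto intro!: always_eventually less_imp_le simp: inverse_eq_divide add.commute\<close>)
    ultimately have "(\<lambda>n. H n (cis l) - (H n (cis l) - p n l)) \<longlonglongrightarrow> b l - 0"
      by (rule tendsto_diff)
    then show ?thesis by simp
  qed
  have "AE l in lebesgue. l \<notin> N"
    using N by (simp add: negligible_iff_null_sets AE_not_in)
  then have "AE l in lborel. l \<notin> N" by (simp add: AE_completion_iff)
  then have "AE l in lborel. l \<in> {-pi..pi} \<longrightarrow> l \<notin> N" by eventually_elim simp
  then have "AE l in circ. l \<notin> N" by (simp only: AE_circ)
  with AE_circ_interior have "AE l in circ. (\<lambda>n. p n l) \<longlonglongrightarrow> b l"
    by eventually_elim (auto intro: conv)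
  with p bound show ?thesis by blast
qed

section \<open>Fourier coefficients\<close>

lemma norm_vec_le_sum: "norm (v :: complex^'t) \<le> (\<Sum>i\<in>UNIV. cmod (v $ i))"
  unfolding norm_vec_def by (rule L2_set_le_sum) simp

lemma gen_span_cases:
  assumes "p \<in> gen_span S"
  obtains E w where "finite E" "E \<subseteq> (UNIV - S) \<times> UNIV"
    "\<And>l i. p l $ i = (\<Sum>q\<in>E. if snd q = i then w q * fexp (fst q) l else 0)"
proof -
  obtain E w where E: "finite E" "E \<subseteq> (UNIV - S) \<times> UNIV"
    and p: "p = (\<lambda>l. \<Sum>q\<in>E. w q *s (fexp (fst q) l *s axis (snd q) 1))"
    using assms unfolding gen_span_def mem_Collect_eq fexp_def[symmetric] by (elim exE conjE) (rule that)
  have "p l $ i = (\<Sum>q\<in>E. if snd q = i then w q * fexp (fst q) l else 0)" for l i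
    unfolding p sum_component by (rule sum.cong) (auto simp: axis_def)
  with E show thesis by (rule that)
qed

lemma gen_span_measurable:
  fixes p :: "real \<Rightarrow> complex^'t"
  assumes "p \<in> gen_span S" shows "p \<in> borel_measurable lborel"
proof (rule borel_measurable_vecI)
  fix i :: 't
  obtain E w where E: "finite E" "E \<subseteq> (UNIV - S) \<times> UNIV"
    and p: "\<And>l i. p l $ i = (\<Sum>q\<in>E. if snd q = i then w q * fexp (fst q) l else 0)"
    by (rule gen_span_cases[OF assms]) (rule that)
  have "(\<lambda>l. if snd q = i then w q * fexp (fst q) l else 0) \<in> borel_measurable lborel" for q
    by (cases "snd q = i") simp_all
  then show "(\<lambda>l. p l $ i) \<in> borel_measurable lborel"
    unfolding p by (rule borel_measurable_sum)
qed

lemma gen_span_bounded: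
  assumes "p \<in> gen_span S"
  shows "\<exists>K. \<forall>l i. cmod (p l $ i) \<le> K"
proof -
  obtain E w where E: "finite E" "E \<subseteq> (UNIV - S) \<times> UNIV"
    and p: "\<And>l i. p l $ i = (\<Sum>q\<in>E. if snd q = i then w q * fexp (fst q) l else 0)"
    by (rule gen_span_cases[OF assms]) (rule that)
  have "cmod (p l $ i) \<le> (\<Sum>q\<in>E. cmod (w q))" for l i
    unfolding p by (rule sum_norm_le) (simp add: norm_mult)
  then show ?thesis by blast
qed

lemma trig_vec_nth: "trig_vec S c l $ i = (\<Sum>k\<in>S. fexp k l * c k $ i)"
  by (simp add: trig_vec_def fexp_def)

lemma trig_vec_measurable: "trig_vec S c \<in> borel_measurable lborel"
  by (rule borel_measurable_vecI) (simp add: trig_vec_nth)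

lemma trig_vec_le: "cmod (trig_vec S c l $ i) \<le> (\<Sum>k\<in>S. cmod (c k $ i))"
  unfolding trig_vec_nth by (rule sum_norm_le) (simp add: norm_mult)

lemma trig_vec_bounded: "\<exists>K. \<forall>l i. cmod (trig_vec S c l $ i) \<le> K"
proof -
  have "cmod (trig_vec S c l $ i) \<le> (\<Sum>i\<in>UNIV. \<Sum>k\<in>S. cmod (c k $ i))" for l i
    using trig_vec_le[of S c l i] member_le_sum[of i UNIV "\<lambda>i. \<Sum>k\<in>S. cmod (c k $ i)"]
    by (simp add: sum_nonneg)
  then show ?thesis by blast
qed

lemma norm_trig_vec_le: "norm (trig_vec S c l) \<le> (\<Sum>i\<in>UNIV. \<Sum>k\<in>S. cmod (c k $ i))"
  using norm_vec_le_sum[of "trig_vec S c l"] sum_mono[of UNIV "\<lambda>i. cmod (trig_vec S c l $ i)", OF trig_vec_le] by (rule order_trans)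

definition fcoef :: "(real \<Rightarrow> complex^'t) \<Rightarrow> int \<Rightarrow> complex^'t" where
  "fcoef b k = (\<chi> i. complex_of_real (1 / (2 * pi)) * (\<integral>l. b l $ i * fexp (- k) l \<partial>circ))"

lemma fcoef_diff:
  assumes "\<And>i. integrable circ (\<lambda>l. b l $ i)" "\<And>i. integrable circ (\<lambda>l. d l $ i)"
  shows "fcoef (\<lambda>l. b l - d l) k = fcoef b k - fcoef d k"
  using assms[THEN integrable_circ_mult_fexp]
  by (simp add: fcoef_def vec_eq_iff left_diff_distrib right_diff_distrib diff_divide_distrib)

text \<open>The frequency map \<open>m\<close> need not be injective, so the same computation serves
  sums over S and sums over pairs (frequency, coordinate).\<close>

lemma fcoef_monomial_sum:
  assumes "finite E"
  shows "complex_of_real (1 / (2 * pi)) * (\<integral>l. (\<Sum>q\<in>E. w q * fexp (m q) l) * fexp (- k) l \<partial>circ)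
    = (\<Sum>q\<in>E. if m q = k then w q else 0)"
proof -
  have "(\<integral>l. (\<Sum>q\<in>E. w q * fexp (m q) l) * fexp (- k) l \<partial>circ)
      = (\<integral>l. (\<Sum>q\<in>E. w q * fexp (m q - k) l) \<partial>circ)"
    by (intro Bochner_Integration.integral_cong refl)
       (simp only: sum_distrib_right mult.assoc fexp_add diff_conv_add_uminus)
  also have "\<dots> = (\<Sum>q\<in>E. w q * integral\<^sup>L circ (fexp (m q - k)))"
    by (subst Bochner_Integration.integral_sum) (auto intro: integrable_fexp)
  also have "\<dots> = (\<Sum>q\<in>E. complex_of_real (2 * pi) * (if m q = k then w q else 0))"
    unfolding integral_fexp by (rule sum.cong) auto
  finally show ?thesis unfolding sum_distrib_left[symmetric] by simp
qed

lemma fcoef_trig_vec: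
  assumes "finite S" "k \<in> S"
  shows "fcoef (trig_vec S c) k = c k"
proof (rule vec_eq_iff[THEN iffD2], rule allI)
  fix i
  have "fcoef (trig_vec S c) k $ i = (\<Sum>q\<in>S. if q = k then c q $ i else 0)"
    using fcoef_monomial_sum[OF assms(1), of "\<lambda>q. c q $ i" "\<lambda>q. q" k]
    by (simp add: fcoef_def trig_vec_nth mult.commute)
  then show "fcoef (trig_vec S c) k $ i = c k $ i" using assms by simp
qed

lemma fcoef_gen_span_zero:
  assumes "p \<in> gen_span S" "k \<in> S"
  shows "fcoef p k = 0"
proof (rule vec_eq_iff[THEN iffD2], rule allI)
  fix i
  obtain E w where E: "finite E" "E \<subseteq> (UNIV - S) \<times> UNIV"
    and p: "\<And>l i. p l $ i = (\<Sum>q\<in>E. if snd q = i then w q * fexp (fst q) l else 0)"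
    by (rule gen_span_cases[OF assms(1)]) (rule that)
  have p': "p l $ i = (\<Sum>q\<in>E. (if snd q = i then w q else 0) * fexp (fst q) l)" for l
    unfolding p by (rule sum.cong) auto
  have "fcoef p k $ i = (\<Sum>q\<in>E. if fst q = k then if snd q = i then w q else 0 else 0)"
    using fcoef_monomial_sum[OF E(1), of "\<lambda>q. if snd q = i then w q else 0" fst k]
    by (simp add: fcoef_def p')
  also have "\<dots> = 0" using E assms(2) by (intro sum.neutral) auto
  finally show "fcoef p k $ i = 0 $ i" by simp
qed

text \<open>By orthogonality of the exponentials, the subtracted polynomial consists exactly of the
  monomials with frequency in S; the others survive unchanged.\<close>

lemma gen_span_remove_frequencies:
  fixes p :: "real \<Rightarrow> complex^'t"
  assumes "p \<in> gen_span {}" "finite S"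
  shows "(\<lambda>l. p l - trig_vec S (fcoef p) l) \<in> gen_span S"
proof -
  obtain E w where E: "finite E" "E \<subseteq> (UNIV - {}) \<times> UNIV"
    and p: "\<And>l i. p l $ i = (\<Sum>q\<in>E. if snd q = i then w q * fexp (fst q) l else 0)"
    by (rule gen_span_cases[OF assms(1)]) (rule that)
  have p': "p l $ i = (\<Sum>q\<in>E. (if snd q = i then w q else 0) * fexp (fst q) l)" for l i
    unfolding p by (rule sum.cong) auto
  have co: "fcoef p k $ i = (\<Sum>q\<in>E. if fst q = k then if snd q = i then w q else 0 else 0)" for k i
    using fcoef_monomial_sum[OF E(1), of "\<lambda>q. if snd q = i then w q else 0" fst k]
    by (simp add: fcoef_def p')
  let ?E = "E - S \<times> UNIV"
  have "(p l - trig_vec S (fcoef p) l) $ i = (\<Sum>q\<in>?E. w q *s (fexp (fst q) l *s axis (snd q) 1)) $ i" for l i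
  proof -
    have "trig_vec S (fcoef p) l $ i = (\<Sum>k\<in>S. \<Sum>q\<in>E. if fst q = k then (if snd q = i then w q else 0) * fexp k l else 0)"
      unfolding trig_vec_nth co sum_distrib_left by (intro sum.cong refl) auto
    also have "\<dots> = (\<Sum>q\<in>E. \<Sum>k\<in>S. if fst q = k then (if snd q = i then w q else 0) * fexp k l else 0)"
      by (rule sum.swap)
    also have "\<dots> = (\<Sum>q\<in>E. if fst q \<in> S then (if snd q = i then w q else 0) * fexp (fst q) l else 0)"
      using assms(2) by (intro sum.cong refl) (simp add: sum.delta' eq_commute)
    finally have "(p l - trig_vec S (fcoef p) l) $ i
       = (\<Sum>q\<in>E. if fst q \<in> S then 0 else (if snd q = i then w q else 0) * fexp (fst q) l)"
      unfolding vector_minus_component p' by (simp only: sum_subtractf[symmetric]) (rule sum.cong, auto)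
    also have "\<dots> = (\<Sum>q\<in>?E. w q * (fexp (fst q) l * axis (snd q) 1 $ i))"
      by (rule sum.mono_neutral_cong_right) (use E in \<open>auto simp: axis_def\<close>)
    finally show ?thesis by (simp add: mult.assoc)
  qed
  then have "(\<lambda>l. p l - trig_vec S (fcoef p) l) = (\<lambda>l. \<Sum>q\<in>?E. w q *s (fexp (fst q) l *s axis (snd q) 1))"
    by (simp add: vec_eq_iff fun_eq_iff)
  then show ?thesis unfolding gen_span_def mem_Collect_eq fexp_def[symmetric] using E
    by (intro exI[of _ ?E] exI[of _ w]) auto
qed

text \<open>As one factor is a polynomial, both sides are finite sums of the same integrals, and
  integrable coordinates of \<open>b\<close> suffice.\<close>

lemma parseval_trig_vec:
  fixes c :: "int \<Rightarrow> complex^'t"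
  assumes "finite S" "\<And>i. integrable circ (\<lambda>l. b l $ i)"
  shows "(\<Sum>k\<in>S. \<Sum>i\<in>UNIV. c k $ i * cnj (fcoef b k $ i))
    = complex_of_real (1 / (2 * pi)) * (\<integral>l. cdot (trig_vec S c l) (b l) \<partial>circ)"
proof -
  have int: "integrable circ (\<lambda>l. cnj (b l $ i * fexp (- k) l))" for i k
    by (intro integrable_cnj integrable_circ_mult_fexp assms(2))
  have "cdot (trig_vec S c l) (b l) = (\<Sum>k\<in>S. \<Sum>i\<in>UNIV. c k $ i * cnj (b l $ i * fexp (- k) l))" for l
    unfolding cdot_def trig_vec_nth sum_distrib_right complex_cnj_mult cnj_fexp
    by (subst sum.swap) (simp add: mult_ac)
  then have "(\<integral>l. cdot (trig_vec S c l) (b l) \<partial>circ)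
      = (\<integral>l. (\<Sum>k\<in>S. \<Sum>i\<in>UNIV. c k $ i * cnj (b l $ i * fexp (- k) l)) \<partial>circ)"
    by (simp only:)
  also have "\<dots> = (\<Sum>k\<in>S. \<Sum>i\<in>UNIV. \<integral>l. c k $ i * cnj (b l $ i * fexp (- k) l) \<partial>circ)"
    using int by (simp only: Bochner_Integration.integral_sum integrable_mult_right Bochner_Integration.integrable_sum)
  also have "\<dots> = (\<Sum>k\<in>S. \<Sum>i\<in>UNIV. c k $ i * cnj (\<integral>l. b l $ i * fexp (- k) l \<partial>circ))"
    by (simp only: integral_mult_right_zero Bochner_Integration.integral_cnj)
  finally show ?thesis by (simp add: fcoef_def sum_distrib_left mult_ac)
qed

section \<open>Block Toeplitz matrices as Fourier coefficients of products\<close>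

lemma trig_vec_mult_nth:
  fixes M :: "real \<Rightarrow> complex^'t^'t"
  shows "(trig_vec S a l v* M l) $ i = (\<Sum>q\<in>S \<times> UNIV. stack a q * (M l $ snd q $ i * fexp (fst q) l))"
proof -
  have "(trig_vec S a l v* M l) $ i = (\<Sum>j\<in>UNIV. \<Sum>k\<in>S. stack a (k, j) * (M l $ j $ i * fexp k l))"
    by (simp add: vector_matrix_mult_def trig_vec_nth sum_distrib_right sum_distrib_left stack_def mult_ac)
  also have "\<dots> = (\<Sum>k\<in>S. \<Sum>j\<in>UNIV. stack a (k, j) * (M l $ j $ i * fexp k l))" by (rule sum.swap)
  finally show ?thesis by (simp add: sum.cartesian_product split_beta)
qed

lemma integrable_trig_vec_mult:
  fixes M :: "real \<Rightarrow> complex^'t^'t"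
  assumes "\<And>i j. integrable circ (\<lambda>l. M l $ i $ j)"
  shows "integrable circ (\<lambda>l. (trig_vec S a l v* M l) $ i)"
  unfolding trig_vec_mult_nth
  by (intro Bochner_Integration.integrable_sum integrable_mult_right integrable_circ_mult_fexp assms)

lemma toep_fexp:
  "toep M p q = complex_of_real (1 / (2 * pi)) * (\<integral>l. M l $ snd q $ snd p * fexp (fst q - fst p) l \<partial>circ)"
  by (simp only: toep_def fexp_def set_integral_circ)

text \<open>\<open>toep M\<close> is multiplication by M followed by reading off the coefficients in
  S. Rows multiplying from the left produce the transpose in its blocks, and e^{ijl} e^{-ikl}
  produces the frequency j - k.\<close>

lemma fcoef_trig_vec_mult:
  fixes M :: "real \<Rightarrow> complex^'t^'t"
  assumes "\<And>i j. integrable circ (\<lambda>l. M l $ i $ j)"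
  shows "fcoef (\<lambda>l. trig_vec S a l v* M l) k $ i = mvec (S \<times> UNIV) (toep M) (stack a) (k, i)"
proof -
  have "(\<integral>l. (trig_vec S a l v* M l) $ i * fexp (- k) l \<partial>circ)
     = (\<integral>l. (\<Sum>q\<in>S \<times> UNIV. stack a q * (M l $ snd q $ i * fexp (fst q - k) l)) \<partial>circ)"
    unfolding trig_vec_mult_nth
    by (intro Bochner_Integration.integral_cong refl)
       (simp only: sum_distrib_right mult.assoc fexp_add diff_conv_add_uminus)
  also have "\<dots> = (\<Sum>q\<in>S \<times> UNIV. stack a q * (\<integral>l. M l $ snd q $ i * fexp (fst q - k) l \<partial>circ))"
    by (simp only: Bochner_Integration.integral_sum integrable_mult_right integrable_circ_mult_fexp assms
       integral_mult_right_zero)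
  finally show ?thesis
    unfolding fcoef_def mvec_def toep_fexp fst_conv snd_conv vec_lambda_beta
    by (simp only: sum_distrib_left mult_ac)
qed

text \<open>Parseval for A and A M. The matrix ends up in the conjugated argument of
  \<open>cinner\<close>, and the Hermitian symmetry of M moves it back to the first one.\<close>

lemma quadratic_form_toep:
  fixes M :: "real \<Rightarrow> complex^'t^'t"
  assumes "finite S" and M: "\<And>i j. integrable circ (\<lambda>l. M l $ i $ j)"
    and herm: "AE l in circ. \<forall>i j. M l $ i $ j = cnj (M l $ j $ i)"
  shows "cinner (S \<times> UNIV) (stack a) (mvec (S \<times> UNIV) (toep M) (stack a))
    = complex_of_real (1 / (2 * pi)) * (\<integral>l. qform (trig_vec S a l) (M l) \<partial>circ)"
proof -
  have "cinner (S \<times> UNIV) (stack a) (mvec (S \<times> UNIV) (toep M) (stack a))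
    = (\<Sum>k\<in>S. \<Sum>i\<in>UNIV. a k $ i * cnj (fcoef (\<lambda>l. trig_vec S a l v* M l) k $ i))"
    unfolding fcoef_trig_vec_mult[OF M] cinner_def sum.cartesian_product by (simp add: split_beta stack_def)
  also have "\<dots> = complex_of_real (1 / (2 * pi)) * (\<integral>l. cdot (trig_vec S a l) (trig_vec S a l v* M l) \<partial>circ)"
    by (rule parseval_trig_vec[OF assms(1) integrable_trig_vec_mult[OF M]])
  also have "(\<integral>l. cdot (trig_vec S a l) (trig_vec S a l v* M l) \<partial>circ) = (\<integral>l. qform (trig_vec S a l) (M l) \<partial>circ)"
  proof (rule integral_cong_AE)
    have m: "trig_vec S a \<in> borel_measurable circ" by (rule measurable_circ[OF trig_vec_measurable])
    note m' = borel_measurable_integrable[OF M]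
    show "(\<lambda>l. cdot (trig_vec S a l) (trig_vec S a l v* M l)) \<in> borel_measurable circ"
      by (intro borel_measurable_cdot borel_measurable_vector_matrix_mult m m')
    show "(\<lambda>l. qform (trig_vec S a l) (M l)) \<in> borel_measurable circ"
      by (intro borel_measurable_qform m m')
    show "AE l in circ. cdot (trig_vec S a l) (trig_vec S a l v* M l) = qform (trig_vec S a l) (M l)"
      using herm
    proof eventually_elim
      case (elim l)
      show ?case by (simp only: qform_eq_cdot cdot_hermitian[OF elim])
    qed
  qed
  finally show ?thesis .
qed

lemma integrable_qform_bounded:
  fixes M :: "real \<Rightarrow> complex^'t^'t"
  assumes b: "b \<in> borel_measurable circ" and K: "\<forall>l i. cmod (b l $ i) \<le> K"
    and M: "\<And>i j. integrable circ (\<lambda>l. M l $ i $ j)"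
  shows "integrable circ (\<lambda>l. qform (b l) (M l))"
  unfolding qform_def
proof (intro Bochner_Integration.integrable_sum)
  fix i j
  note [measurable] = borel_measurable_vec_nth[OF b] borel_measurable_integrable[OF M]
  have [measurable]: "cnj \<in> borel_measurable borel"
    by (intro borel_measurable_continuous_onI continuous_intros)
  show "integrable circ (\<lambda>l. b l $ i * M l $ i $ j * cnj (b l $ j))"
  proof (rule Bochner_Integration.integrable_bound)
    show "integrable circ (\<lambda>l. K * cmod (M l $ i $ j) * K)"
      by (intro integrable_mult_left integrable_mult_right integrable_norm M)
    show "(\<lambda>l. b l $ i * M l $ i $ j * cnj (b l $ j)) \<in> borel_measurable circ" by measurable
    have "0 \<le> K" using K norm_ge_zero order_trans by blast
    then show "AE l in circ. norm (b l $ i * M l $ i $ j * cnj (b l $ j)) \<le> norm (K * cmod (M l $ i $ j) * K)"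
      using K by (intro AE_I2) (simp add: norm_mult mult_mono)
  qed
qed

lemma integrable_qform_trig_vec:
  fixes M :: "real \<Rightarrow> complex^'t^'t"
  assumes "\<And>i j. integrable circ (\<lambda>l. M l $ i $ j)"
  shows "integrable circ (\<lambda>l. qform (trig_vec S c l) (M l))"
proof -
  obtain K where "\<forall>l i. cmod (trig_vec S c l $ i) \<le> K" using trig_vec_bounded by blast
  from integrable_qform_bounded[OF measurable_circ[OF trig_vec_measurable] this assms] show ?thesis .
qed

section \<open>Weighted spaces and the optimal estimate\<close>

lemma L2_iff: "L2 F b \<longleftrightarrow> b \<in> borel_measurable lborel \<and> integrable circ (\<lambda>l. Re (qform (b l) (F l)))"
  by (simp add: L2_def set_integrable_circ)

lemma L2dist_circ: "L2dist F b d = (\<integral>l. Re (qform (b l - d l) (F l)) \<partial>circ)"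
  by (simp add: L2dist_def set_integral_circ)

lemma borel_measurable_Re_qform:
  fixes F :: "'a \<Rightarrow> complex^'t^'t"
  assumes "b \<in> borel_measurable M" "\<And>i j. (\<lambda>l. F l $ i $ j) \<in> borel_measurable M"
  shows "(\<lambda>l. Re (qform (b l) (F l))) \<in> borel_measurable M"
  using borel_measurable_qform[OF assms] by measurable

section \<open>The space L2 of one integrable density, and the density of trigonometric polynomials
  in it\<close>

locale integrable_density =
  fixes F :: "real \<Rightarrow> complex^'t^'t"
  assumes F_meas: "\<And>i j. (\<lambda>l. F l $ i $ j) \<in> borel_measurable lborel"
    and F_int: "\<And>i j. integrable circ (\<lambda>l. F l $ i $ j)"
    and F_psd: "AE l in circ. herm_psd (F l)"
begin

lemma Re_qform_meas: "b \<in> borel_measurable lborel \<Longrightarrow> (\<lambda>l. Re (qform (b l) (F l))) \<in> borel_measurable circ"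
  by (intro borel_measurable_Re_qform measurable_circ F_meas)

lemma trace_int: "integrable circ (\<lambda>l. Re (trace (F l)))"
  unfolding trace_def by (intro integrable_Re Bochner_Integration.integrable_sum F_int)

lemma L2_bounded:
  assumes "b \<in> borel_measurable lborel" "\<forall>l i. cmod (b l $ i) \<le> K"
  shows "L2 F b"
  unfolding L2_iff
  using assms(1) integrable_Re[OF integrable_qform_bounded[OF measurable_circ[OF assms(1)] assms(2) F_int]] by simp

lemma L2_gen_span: "p \<in> gen_span S \<Longrightarrow> L2 F p"
  using gen_span_bounded L2_bounded gen_span_measurable by blast

lemma L2_trig_vec: "L2 F (trig_vec S c)"
  using trig_vec_bounded L2_bounded trig_vec_measurable by blast

lemma L2_diff:
  assumes "L2 F b" "L2 F d"
  shows "L2 F (\<lambda>l. b l - d l)"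
proof -
  have m: "(\<lambda>l. b l - d l) \<in> borel_measurable lborel"
    using assms by (auto simp: L2_iff)
  have "integrable circ (\<lambda>l. Re (qform (b l - d l) (F l)))"
  proof (rule Bochner_Integration.integrable_bound)
    show "integrable circ (\<lambda>l. 2 * Re (qform (b l) (F l)) + 2 * Re (qform (d l) (F l)))"
      using assms by (auto simp: L2_iff)
    show "AE l in circ. norm (Re (qform (b l - d l) (F l)))
       \<le> norm (2 * Re (qform (b l) (F l)) + 2 * Re (qform (d l) (F l)))"
      using F_psd
    proof eventually_elim
      case (elim l)
      then show ?case
        using qform_diff_le[OF elim, of "b l" "d l"] herm_psdD(2)[OF elim, of "b l - d l"] by simp
    qed
  qed (rule Re_qform_meas[OF m])
  with m show ?thesis by (simp add: L2_iff)
qed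

lemma L2dist_triangle:
  assumes "L2 F b" "L2 F d" "L2 F e"
  shows "L2dist F b e \<le> 2 * L2dist F b d + 2 * L2dist F d e"
proof -
  have "L2dist F b e \<le> (\<integral>l. 2 * Re (qform (b l - d l) (F l)) + 2 * Re (qform (d l - e l) (F l)) \<partial>circ)"
    unfolding L2dist_circ
  proof (rule integral_mono_AE)
    show "integrable circ (\<lambda>l. Re (qform (b l - e l) (F l)))"
      using L2_diff[OF assms(1,3)] by (simp add: L2_iff)
    show "integrable circ (\<lambda>l. 2 * Re (qform (b l - d l) (F l)) + 2 * Re (qform (d l - e l) (F l)))"
      using L2_diff[OF assms(1,2)] L2_diff[OF assms(2,3)] by (simp add: L2_iff)
    show "AE l in circ. Re (qform (b l - e l) (F l))
        \<le> 2 * Re (qform (b l - d l) (F l)) + 2 * Re (qform (d l - e l) (F l))"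
      using F_psd
    proof eventually_elim
      case (elim l)
      then show ?case using qform_add_le[OF elim, of "b l - d l" "d l - e l"] by simp
    qed
  qed
  also have "\<dots> = 2 * L2dist F b d + 2 * L2dist F d e"
    using L2_diff[OF assms(1,2)] L2_diff[OF assms(2,3)] by (simp add: L2_iff L2dist_circ)
  finally show ?thesis .
qed

lemma L2dist_nonneg: "0 \<le> L2dist F b d"
  unfolding L2dist_circ using F_psd
  by (intro integral_nonneg_AE) (auto elim!: eventually_mono intro: herm_psdD(2))

text \<open>Dominated convergence: the integrand is at most the integrable trace of F times a
  constant and the squared length of \<open>b l - p n l\<close>, which is bounded and tends to
  zero.\<close>

lemma L2dist_bounded_tendsto:
  assumes b: "b \<in> borel_measurable lborel" and K: "\<And>l. norm (b l) \<le> K"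
    and p: "\<And>n. p n \<in> borel_measurable lborel" "\<And>n l. norm (p n l) \<le> K'"
    and lim: "AE l in circ. (\<lambda>n. p n l) \<longlonglongrightarrow> b l"
  shows "(\<lambda>n. L2dist F b (p n)) \<longlonglongrightarrow> 0"
proof -
  let ?T = "(real CARD('t))\<^sup>2"
  have "(\<lambda>n. \<integral>l. Re (qform (b l - p n l) (F l)) \<partial>circ) \<longlonglongrightarrow> (\<integral>l. 0 \<partial>circ)"
  proof (rule integral_dominated_convergence)
    show "integrable circ (\<lambda>l. ?T * Re (trace (F l)) * (K + K')\<^sup>2)"
      by (intro integrable_mult_left integrable_mult_right trace_int)
    show "AE l in circ. (\<lambda>n. Re (qform (b l - p n l) (F l))) \<longlonglongrightarrow> 0"
      using F_psd lim
    proof eventually_elim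
      case (elim l)
      have "(\<lambda>n. ?T * Re (trace (F l)) * (norm (b l - p n l))\<^sup>2) \<longlonglongrightarrow> ?T * Re (trace (F l)) * (norm (b l - b l))\<^sup>2"
        by (intro tendsto_intros elim)
      then have lim0: "(\<lambda>n. ?T * Re (trace (F l)) * (norm (b l - p n l))\<^sup>2) \<longlonglongrightarrow> 0" by simp
      show ?case
      proof (rule Lim_null_comparison[OF _ lim0], rule always_eventually, rule allI)
        fix n
        show "norm (Re (qform (b l - p n l) (F l))) \<le> ?T * Re (trace (F l)) * (norm (b l - p n l))\<^sup>2"
          using psd_qform_le_trace[OF elim(1)] herm_psdD(2)[OF elim(1)] by (simp only: real_norm_def abs_of_nonneg)
      qed
    qed
    show "AE l in circ. norm (Re (qform (b l - p n l) (F l))) \<le> ?T * Re (trace (F l)) * (K + K')\<^sup>2" for n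
      using F_psd
    proof eventually_elim
      case (elim l)
      have "norm (b l - p n l) \<le> K + K'"
        using norm_triangle_ineq4[of "b l" "p n l"] K[of l] p(2)[of n l] by linarith
      moreover have "0 \<le> Re (trace (F l))"
        using psd_entry_le_trace[OF elim] norm_ge_zero order_trans by blast
      ultimately have "?T * Re (trace (F l)) * (norm (b l - p n l))\<^sup>2 \<le> ?T * Re (trace (F l)) * (K + K')\<^sup>2"
        by (intro mult_left_mono power_mono) auto
      with psd_qform_le_trace[OF elim, of "b l - p n l"] herm_psdD(2)[OF elim, of "b l - p n l"]
      show ?case unfolding real_norm_def by linarith
    qed
  qed (use b p in \<open>auto intro!: Re_qform_meas\<close>)
  then show ?thesis by (simp add: L2dist_circ)
qed

lemma trig_dense_bounded:
  assumes b: "b \<in> borel_measurable lborel" and K: "\<And>l. norm (b l) \<le> K" and e: "0 < e"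
  shows "\<exists>p\<in>gen_span {}. L2dist F b p < e"
proof -
  obtain p where p: "\<forall>n. p n \<in> gen_span {}" "\<forall>n l. norm (p n l) \<le> K + 1"
    "AE l in circ. (\<lambda>n. p n l) \<longlonglongrightarrow> b l"
    using trig_approx_bounded[OF b K] by blast
  have "(\<lambda>n. L2dist F b (p n)) \<longlonglongrightarrow> 0"
    using p by (intro L2dist_bounded_tendsto[OF b K _ _ p(3)]) (blast intro: gen_span_measurable)+
  then have "eventually (\<lambda>n. L2dist F b (p n) < e) sequentially"
    using e by (rule order_tendstoD)
  then obtain n where "L2dist F b (p n) < e" by (auto simp: eventually_sequentially)
  with p(1) show ?thesis by blast
qed

lemma trig_dense:
  assumes b: "L2 F b" and e: "0 < e"
  shows "\<exists>p\<in>gen_span {}. L2dist F b p < e"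
proof -
  have bm: "b \<in> borel_measurable lborel" and bi: "integrable circ (\<lambda>l. Re (qform (b l) (F l)))"
    using b by (auto simp: L2_iff)
  \<comment> \<open>Truncation by size: the difference from \<open>b\<close> is 0 or
    \<open>b\<close> itself, so its form is dominated by that of \<open>b\<close> and vanishes for
    large \<open>n\<close>.\<close>
  define t where "t n l = (if norm (b l) \<le> real n then b l else 0)" for n l
  have tm: "t n \<in> borel_measurable lborel" for n
    unfolding t_def using bm by measurable
  have "(\<lambda>n. \<integral>l. Re (qform (b l - t n l) (F l)) \<partial>circ) \<longlonglongrightarrow> (\<integral>l. 0 \<partial>circ)"
  proof (rule integral_dominated_convergence)
    show "AE l in circ. (\<lambda>n. Re (qform (b l - t n l) (F l))) \<longlonglongrightarrow> 0"
    proof (rule AE_I2)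
      fix l
      obtain m where "norm (b l) \<le> real m" using real_arch_simple by blast
      then have "Re (qform (b l - t n l) (F l)) = 0" if "m \<le> n" for n
        using that by (simp add: t_def qform_def)
      then show "(\<lambda>n. Re (qform (b l - t n l) (F l))) \<longlonglongrightarrow> 0"
        by (intro tendsto_eventually) (auto simp: eventually_sequentially)
    qed
    show "AE l in circ. norm (Re (qform (b l - t n l) (F l))) \<le> Re (qform (b l) (F l))" for n
      using F_psd by eventually_elim (auto simp: t_def herm_psdD(2) qform_def[of 0])
  qed (use bm tm bi in \<open>auto intro!: Re_qform_meas\<close>)
  then have "(\<lambda>n. L2dist F b (t n)) \<longlonglongrightarrow> 0" by (simp add: L2dist_circ)
  \<comment> \<open>The two errors \<open>e / 4\<close> are doubled by
    \<open>L2dist_triangle\<close> and add up to \<open>e\<close>.\<close>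
  then have "eventually (\<lambda>n. L2dist F b (t n) < e / 4) sequentially"
    using e by (intro order_tendstoD) auto
  then obtain n where n: "L2dist F b (t n) < e / 4" by (auto simp: eventually_sequentially)
  have tb: "norm (t n l) \<le> real n" for l by (simp add: t_def)
  obtain p where p: "p \<in> gen_span {}" "L2dist F (t n) p < e / 4"
    using trig_dense_bounded[OF tm tb, of "e / 4"] e by auto
  have "L2 F (t n)"
    using tb order_trans[OF Finite_Cartesian_Product.norm_nth_le tb] by (intro L2_bounded[OF tm]) blast
  from L2dist_triangle[OF b this L2_gen_span[OF p(1)]] n p(2)
  have "L2dist F b p < e" by linarith
  with p(1) show ?thesis by blast
qed

text \<open>Controls a polynomial with frequencies in S by its coefficients alone, so that the part
  removed from an approximant becomes small once these coefficients do.\<close>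

lemma L2dist_trig_vec_le:
  "(\<integral>l. Re (qform (trig_vec S c l) (F l)) \<partial>circ)
    \<le> (real CARD('t))\<^sup>2 * (\<integral>l. Re (trace (F l)) \<partial>circ) * (\<Sum>i\<in>UNIV. \<Sum>k\<in>S. cmod (c k $ i))\<^sup>2"
proof -
  let ?T = "(real CARD('t))\<^sup>2" and ?s = "(\<Sum>i\<in>UNIV. \<Sum>k\<in>S. cmod (c k $ i))\<^sup>2"
  have "(\<integral>l. Re (qform (trig_vec S c l) (F l)) \<partial>circ) \<le> (\<integral>l. ?T * Re (trace (F l)) * ?s \<partial>circ)"
  proof (rule integral_mono_AE)
    show "integrable circ (\<lambda>l. Re (qform (trig_vec S c l) (F l)))"
      using L2_trig_vec by (simp add: L2_iff)
    show "integrable circ (\<lambda>l. ?T * Re (trace (F l)) * ?s)"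
      by (intro integrable_mult_left integrable_mult_right trace_int)
    show "AE l in circ. Re (qform (trig_vec S c l) (F l)) \<le> ?T * Re (trace (F l)) * ?s"
      using F_psd
    proof eventually_elim
      case (elim l)
      have "0 \<le> Re (trace (F l))"
        using psd_entry_le_trace[OF elim] norm_ge_zero order_trans by blast
      then have "?T * Re (trace (F l)) * (norm (trig_vec S c l))\<^sup>2 \<le> ?T * Re (trace (F l)) * ?s"
        by (intro mult_left_mono power_mono norm_trig_vec_le) auto
      with psd_qform_le_trace[OF elim, of "trig_vec S c l"] show ?case by linarith
    qed
  qed
  then show ?thesis by simp
qed

end

section \<open>Consequences of minimality: Fourier coefficients on L2(F), the observation space, and
  the matrix B\<close>

locale minimal_pair =
  fixes f g :: "real \<Rightarrow> complex^'t^'t"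
  assumes sf: "spectral_density f" and sg: "spectral_density g"
    and inv: "AE l in circ. invertible (f l + g l)"
    and tr: "integrable circ (\<lambda>l. trace (matrix_inv (f l + g l)))"
begin

abbreviation "F \<equiv> \<lambda>l. f l + g l"
abbreviation "G \<equiv> \<lambda>l. matrix_inv (F l)"

lemma f_meas: "(\<lambda>l. f l $ i $ j) \<in> borel_measurable lborel"
  and g_meas: "(\<lambda>l. g l $ i $ j) \<in> borel_measurable lborel"
  and f_int: "integrable circ (\<lambda>l. f l $ i $ j)"
  and g_int: "integrable circ (\<lambda>l. g l $ i $ j)"
  using sf sg by (auto simp: spectral_density_def set_integrable_circ)

lemma psd_AE: "AE l in circ. herm_psd (f l)" "AE l in circ. herm_psd (g l)"
  using sf sg by (simp_all add: spectral_density_def AE_circ del: atLeastAtMost_iff)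

lemma pair_AE: "AE l in circ. psd_pair (f l) (g l) (G l)"
  using psd_AE inv
proof eventually_elim
  case (elim l)
  from elim(3) have "F l ** G l = mat 1 \<and> G l ** F l = mat 1"
    unfolding invertible_def matrix_inv_def by (rule someI_ex)
  with elim show ?case by (simp add: psd_pair_def)
qed

sublocale integrable_density F
proof
  show "(\<lambda>l. F l $ i $ j) \<in> borel_measurable lborel" for i j
    using f_meas g_meas by simp
  show "integrable circ (\<lambda>l. F l $ i $ j)" for i j
    using f_int g_int by simp
  show "AE l in circ. herm_psd (F l)"
    using pair_AE by eventually_elim (rule psd_pair.sum_psd)
qed

lemma G_meas: "(\<lambda>l. G l $ i $ j) \<in> borel_measurable lborel"
  by (rule borel_measurable_matrix_inv[OF F_meas])

text \<open>Minimality bounds only the trace, but the inverse is again positive semidefinite, so its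
  trace dominates every entry.\<close>

lemma G_int: "integrable circ (\<lambda>l. G l $ i $ j)"
proof (rule Bochner_Integration.integrable_bound[OF tr])
  show "(\<lambda>l. G l $ i $ j) \<in> borel_measurable circ" by (rule measurable_circ[OF G_meas])
  show "AE l in circ. norm (G l $ i $ j) \<le> norm (trace (G l))"
    using pair_AE
  proof eventually_elim
    case (elim l)
    from psd_entry_le_trace[OF psd_pair.inv_psd[OF elim], of i j] complex_Re_le_cmod[of "trace (G l)"]
    show ?case by (rule order_trans)
  qed
qed

lemma G_hermitian_AE: "AE l in circ. \<forall>i j. G l $ i $ j = cnj (G l $ j $ i)"
  using pair_AE
proof eventually_elim
  case (elim l)
  from psd_pair.inv_psd[OF elim] show ?case unfolding herm_psd_def by blast
qed

lemma fG_int: "integrable circ (\<lambda>l. (f l ** G l) $ i $ j)"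
proof (rule Bochner_Integration.integrable_bound)
  show "integrable circ (\<lambda>l. Re (f l $ i $ i) + Re (G l $ j $ j))"
    using f_int G_int by simp
  show "(\<lambda>l. (f l ** G l) $ i $ j) \<in> borel_measurable circ"
    by (intro measurable_circ borel_measurable_matrix_mult f_meas G_meas)
  show "AE l in circ. norm ((f l ** G l) $ i $ j) \<le> norm (Re (f l $ i $ i) + Re (G l $ j $ j))"
    using pair_AE
  proof eventually_elim
    case (elim l)
    from psd_pair.fG_entry_le[OF elim, of i j] norm_ge_zero[of "(f l ** G l) $ i $ j"]
    show ?case unfolding real_norm_def by linarith
  qed
qed

lemma fGg_int: "integrable circ (\<lambda>l. (f l ** G l ** g l) $ i $ j)"
proof (rule Bochner_Integration.integrable_bound)
  show "integrable circ (\<lambda>l. Re (f l $ i $ i) + Re (g l $ j $ j))"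
    using f_int g_int by simp
  show "(\<lambda>l. (f l ** G l ** g l) $ i $ j) \<in> borel_measurable circ"
    by (intro measurable_circ borel_measurable_matrix_mult f_meas g_meas G_meas)
  show "AE l in circ. norm ((f l ** G l ** g l) $ i $ j) \<le> norm (Re (f l $ i $ i) + Re (g l $ j $ j))"
    using pair_AE
  proof eventually_elim
    case (elim l)
    from psd_pair.fGg_entry_le[OF elim, of i j] norm_ge_zero[of "(f l ** G l ** g l) $ i $ j"]
    show ?case unfolding real_norm_def by linarith
  qed
qed

text \<open>\<open>coordinate_le\<close> with weight 1: both terms on its right are integrable, the
  second one by minimality. Hence Fourier coefficients are meaningful on all of
  \<open>L2 F\<close>.\<close>

lemma L2_coordinate_int:
  assumes "L2 F b" shows "integrable circ (\<lambda>l. b l $ i)"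
proof (rule Bochner_Integration.integrable_bound)
  show "integrable circ (\<lambda>l. Re (qform (b l) (F l)) + Re (G l $ i $ i))"
    using assms G_int by (simp add: L2_iff)
  show "(\<lambda>l. b l $ i) \<in> borel_measurable circ"
    using assms by (intro measurable_circ borel_measurable_vec_nth) (simp add: L2_iff)
  show "AE l in circ. norm (b l $ i) \<le> norm (Re (qform (b l) (F l)) + Re (G l $ i $ i))"
    using pair_AE
  proof eventually_elim
    case (elim l)
    from psd_pair.coordinate_le[OF elim, of 1 "b l" i] norm_ge_zero[of "b l $ i"]
    show ?case unfolding real_norm_def by simp
  qed
qed

text \<open>The integrated form of \<open>coordinate_le\<close>, with the factors 2 and 1/(2 pi)
  estimated generously. The weight \<open>t\<close> stays free, to be adapted to the size of
  \<open>b\<close>.\<close>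

lemma fcoef_le:
  assumes "L2 F b" "0 < t"
  shows "cmod (fcoef b k $ i) \<le> t * (\<integral>l. Re (qform (b l) (F l)) \<partial>circ) + (\<integral>l. Re (G l $ i $ i) \<partial>circ) / t"
proof -
  have int: "integrable circ (\<lambda>l. b l $ i)" by (rule L2_coordinate_int[OF assms(1)])
  have "cmod (fcoef b k $ i) = 1 / (2 * pi) * cmod (\<integral>l. b l $ i * fexp (- k) l \<partial>circ)"
    by (simp add: fcoef_def norm_mult norm_divide)
  also have "\<dots> \<le> 1 * cmod (\<integral>l. b l $ i * fexp (- k) l \<partial>circ)"
    using pi_ge_two by (intro mult_right_mono) (auto simp: divide_le_eq)
  also have "\<dots> \<le> (\<integral>l. cmod (b l $ i * fexp (- k) l) \<partial>circ)"
    using integral_norm_bound[of circ "\<lambda>l. b l $ i * fexp (- k) l"] by simp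
  also have "\<dots> = (\<integral>l. cmod (b l $ i) \<partial>circ)" by (simp add: norm_mult)
  also have "\<dots> \<le> (\<integral>l. t * Re (qform (b l) (F l)) + Re (G l $ i $ i) / t \<partial>circ)"
  proof (rule integral_mono_AE)
    show "integrable circ (\<lambda>l. cmod (b l $ i))" using int by (rule integrable_norm)
    show "integrable circ (\<lambda>l. t * Re (qform (b l) (F l)) + Re (G l $ i $ i) / t)"
      using assms G_int by (simp add: L2_iff)
    show "AE l in circ. cmod (b l $ i) \<le> t * Re (qform (b l) (F l)) + Re (G l $ i $ i) / t"
      using pair_AE
    proof eventually_elim
      case (elim l)
      from psd_pair.coordinate_le[OF elim assms(2), of "b l" i] norm_ge_zero[of "b l $ i"]
      show ?case by linarith
    qed
  qed
  also have "\<dots> = t * (\<integral>l. Re (qform (b l) (F l)) \<partial>circ) + (\<integral>l. Re (G l $ i $ i) \<partial>circ) / t"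
    using assms G_int by (simp add: L2_iff)
  finally show ?thesis .
qed

lemma fcoef_tendsto:
  assumes b: "L2 F b" and p: "\<And>n. L2 F (p n)" and lim: "(\<lambda>n. L2dist F b (p n)) \<longlonglongrightarrow> 0"
  shows "(\<lambda>n. fcoef (p n) k $ i) \<longlonglongrightarrow> fcoef b k $ i"
proof -
  define X where "X n = L2dist F b (p n)" for n
  define Y where "Y = (\<integral>l. Re (G l $ i $ i) \<partial>circ)"
  \<comment> \<open>\<open>fcoef_le\<close> is applied with weight \<open>inverse (s n)\<close>: the
    first term is then at most \<open>sqrt (X n)\<close> and the second is \<open>Y * s n\<close>.
    The added \<open>inverse (real (Suc n))\<close> keeps \<open>s n\<close> positive when
    \<open>X n = 0\<close>.\<close>
  define s where "s n = sqrt (X n) + inverse (real (Suc n))" for n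
  have X0: "0 \<le> X n" for n unfolding X_def by (rule L2dist_nonneg)
  have s0: "0 < s n" for n unfolding s_def using X0 by (intro add_nonneg_pos) auto
  have le: "cmod (fcoef b k $ i - fcoef (p n) k $ i) \<le> sqrt (X n) + Y * s n" for n
  proof -
    have "fcoef (\<lambda>l. b l - p n l) k $ i = fcoef b k $ i - fcoef (p n) k $ i"
      by (subst fcoef_diff) (auto intro: L2_coordinate_int b p)
    moreover have "cmod (fcoef (\<lambda>l. b l - p n l) k $ i) \<le> inverse (s n) * X n + Y / inverse (s n)"
      unfolding X_def Y_def L2dist_circ using s0 by (intro fcoef_le L2_diff b p) auto
    moreover have "inverse (s n) * X n \<le> sqrt (X n)"
    proof -
      have "X n = sqrt (X n) * sqrt (X n)" using X0 by simp
      also have "\<dots> \<le> sqrt (X n) * s n"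
        using X0 by (intro mult_left_mono) (auto simp: s_def)
      finally show ?thesis using s0[of n] by (simp add: field_simps)
    qed
    ultimately show ?thesis by (simp add: divide_inverse)
  qed
  have sX: "(\<lambda>n. sqrt (X n)) \<longlonglongrightarrow> 0"
    using tendsto_real_sqrt[OF lim] by (simp add: X_def)
  then have "s \<longlonglongrightarrow> 0 + 0"
    unfolding s_def by (intro tendsto_add LIMSEQ_inverse_real_of_nat)
  with sX have "(\<lambda>n. sqrt (X n) + Y * s n) \<longlonglongrightarrow> 0 + Y * (0 + 0)"
    by (intro tendsto_intros)
  then have lim0: "(\<lambda>n. sqrt (X n) + Y * s n) \<longlonglongrightarrow> 0" by simp
  have "(\<lambda>n. fcoef b k $ i - fcoef (p n) k $ i) \<longlonglongrightarrow> 0"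
    by (rule Lim_null_comparison[OF _ lim0], rule always_eventually, rule allI, rule le)
  from tendsto_diff[OF tendsto_const[of "fcoef b k $ i"] this] show ?thesis by simp
qed

lemma L2s_fcoef_zero:
  assumes "L2s F S b" "k \<in> S"
  shows "fcoef b k = 0"
proof (rule vec_eq_iff[THEN iffD2], rule allI)
  fix i
  obtain p where p: "\<And>n. p n \<in> gen_span S" "(\<lambda>n. L2dist F b (p n)) \<longlonglongrightarrow> 0"
    and b: "L2 F b" using assms(1) by (auto simp: L2s_def)
  have "(\<lambda>n. fcoef (p n) k $ i) \<longlonglongrightarrow> fcoef b k $ i"
    by (rule fcoef_tendsto[OF b L2_gen_span[OF p(1)] p(2)])
  then have "(\<lambda>n. 0) \<longlonglongrightarrow> fcoef b k $ i"
    using fcoef_gen_span_zero[OF p(1) assms(2)] by simp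
  then show "fcoef b k $ i = 0 $ i" by (simp add: LIMSEQ_const_iff)
qed

text \<open>Removing the frequencies in \<open>S\<close> from trigonometric polynomials that approximate \<open>b\<close> changes them
  only by finitely many coefficients, all of which tend to the vanishing ones of \<open>b\<close>.\<close>

lemma L2sI:
  assumes b: "L2 F b" and S: "finite S" and zero: "\<And>k. k \<in> S \<Longrightarrow> fcoef b k = 0"
  shows "L2s F S b"
proof -
  have "\<forall>n. \<exists>p\<in>gen_span {}. L2dist F b p < inverse (real (Suc n))"
    using trig_dense[OF b] by simp
  then obtain p where p: "\<And>n. p n \<in> gen_span {}" and d: "\<And>n. L2dist F b (p n) < inverse (real (Suc n))"
    by metis
  have pL: "L2 F (p n)" for n by (rule L2_gen_span[OF p])
  have lim: "(\<lambda>n. L2dist F b (p n)) \<longlonglongrightarrow> 0"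
  proof (rule Lim_null_comparison[OF _ LIMSEQ_inverse_real_of_nat], rule always_eventually, rule allI)
    fix n
    show "norm (L2dist F b (p n)) \<le> inverse (real (Suc n))"
      using d[of n] L2dist_nonneg[of b "p n"] by (simp only: real_norm_def abs_of_nonneg less_imp_le)
  qed
  define r where "r n l = p n l - trig_vec S (fcoef (p n)) l" for n l
  have r: "r n \<in> gen_span S" for n
    unfolding r_def by (rule gen_span_remove_frequencies[OF p S])
  define \<kappa> where "\<kappa> n = (\<Sum>i\<in>UNIV. \<Sum>k\<in>S. cmod (fcoef (p n) k $ i))" for n
  have "(\<lambda>n. cmod (fcoef (p n) k $ i)) \<longlonglongrightarrow> 0" if "k \<in> S" for k i
    using fcoef_tendsto[OF b pL lim, of k i] zero[OF that] by (simp add: tendsto_norm_zero_iff)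
  then have \<kappa>: "\<kappa> \<longlonglongrightarrow> (\<Sum>i\<in>(UNIV::'t set). \<Sum>k\<in>S. 0)"
    unfolding \<kappa>_def by (intro tendsto_sum)
  define c where "c = (real CARD('t))\<^sup>2 * (\<integral>l. Re (trace (F l)) \<partial>circ)"
  have le: "L2dist F b (r n) \<le> 2 * L2dist F b (p n) + 2 * (c * (\<kappa> n)\<^sup>2)" for n
  proof -
    have "L2dist F (p n) (r n) \<le> c * (\<kappa> n)\<^sup>2"
      unfolding L2dist_circ r_def c_def \<kappa>_def using L2dist_trig_vec_le[of S "fcoef (p n)"] by simp
    with L2dist_triangle[OF b pL L2_gen_span[OF r], of n n] show ?thesis by linarith
  qed
  have "(\<lambda>n. 2 * L2dist F b (p n) + 2 * (c * (\<kappa> n)\<^sup>2)) \<longlonglongrightarrow> 2 * 0 + 2 * (c * (\<Sum>i\<in>(UNIV::'t set). \<Sum>k\<in>S. 0)\<^sup>2)"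
    by (intro tendsto_intros lim \<kappa>)
  then have lim0: "(\<lambda>n. 2 * L2dist F b (p n) + 2 * (c * (\<kappa> n)\<^sup>2)) \<longlonglongrightarrow> 0" by simp
  have "(\<lambda>n. L2dist F b (r n)) \<longlonglongrightarrow> 0"
  proof (rule Lim_null_comparison[OF _ lim0], rule always_eventually, rule allI)
    fix n
    show "norm (L2dist F b (r n)) \<le> 2 * L2dist F b (p n) + 2 * (c * (\<kappa> n)\<^sup>2)"
      using le[of n] L2dist_nonneg[of b "r n"] by (simp only: real_norm_def abs_of_nonneg)
  qed
  with b r show ?thesis unfolding L2s_def by blast
qed

lemma Bmat_toep: "Bmat f g = toep G" and Dmat_toep: "Dmat f g = toep (\<lambda>l. f l ** G l)"
  and Rmat_toep: "Rmat f g = toep (\<lambda>l. f l ** G l ** g l)"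
  by (simp_all add: Bmat_def Dmat_def Rmat_def)

lemma stack_unstack: "stack (unstack x) = x"
  by (simp add: stack_def unstack_def fun_eq_iff)

text \<open>A kernel vector makes the integral of a nonnegative form vanish, so the G-form of its
  polynomial X is zero a.e. By definiteness of G this gives X = 0 a.e., and the Fourier coefficients
  of X recover the vector.\<close>

lemma Bmat_invertible:
  assumes S: "finite S"
  shows "invertible_on (S \<times> UNIV) (Bmat f g)"
proof (rule invertible_onI)
  show "finite (S \<times> (UNIV :: 't set))" using S by simp
  fix x assume x: "\<forall>p\<in>S \<times> UNIV. mvec (S \<times> UNIV) (Bmat f g) x p = 0"
  let ?X = "trig_vec S (unstack x)"
  have "cinner (S \<times> UNIV) x (mvec (S \<times> UNIV) (toep G) x) = 0"
    unfolding cinner_def Bmat_toep[symmetric]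
    by (intro sum.neutral ballI) (simp only: x[rule_format] complex_cnj_zero mult_zero_right)
  moreover have "cinner (S \<times> UNIV) x (mvec (S \<times> UNIV) (toep G) x)
      = complex_of_real (1 / (2 * pi)) * (\<integral>l. qform (?X l) (G l) \<partial>circ)"
    using quadratic_form_toep[OF S G_int G_hermitian_AE, of "unstack x"] by (simp only: stack_unstack)
  ultimately have "(\<integral>l. qform (?X l) (G l) \<partial>circ) = 0" by simp
  moreover have int: "integrable circ (\<lambda>l. qform (?X l) (G l))"
    by (rule integrable_qform_trig_vec[OF G_int])
  ultimately have "(\<integral>l. Re (qform (?X l) (G l)) \<partial>circ) = 0" by simp
  moreover have "AE l in circ. 0 \<le> Re (qform (?X l) (G l))"
    using pair_AE by eventually_elim (rule herm_psdD(2)[OF psd_pair.inv_psd])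
  ultimately have "AE l in circ. Re (qform (?X l) (G l)) = 0"
    using integral_nonneg_eq_0_iff_AE[OF integrable_Re[OF int]] by blast
  with pair_AE have "AE l in circ. ?X l = 0"
  proof eventually_elim
    case (elim l)
    interpret psd_pair "f l" "g l" "G l" by (rule elim)
    let ?b = "?X l v* G l"
    \<comment> \<open>The F-form of \<open>?b\<close> equals the G-form of X, which is zero here; so
      the bound holds for every weight, and a large weight forces the coordinate to vanish.\<close>
    have le: "2 * cmod (?b $ i) \<le> Re (G l $ i $ i) / t" if "0 < t" for i t
      using coordinate_le[OF that, of ?b i] elim by (simp add: qform_F_G)
    have "?b $ i = 0" for i
    proof (rule ccontr)
      assume "?b $ i \<noteq> 0"
      then have pos: "0 < cmod (?b $ i)" by simp
      \<comment> \<open>With this weight the bound is strictly below \<open>cmod (?b $ i)\<close>;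
        the summand 1 keeps the weight positive when the diagonal entry is zero.\<close>
      let ?t = "(Re (G l $ i $ i) + 1) / cmod (?b $ i)"
      have G0: "0 \<le> Re (G l $ i $ i)" by (rule herm_psd_diag_nonneg[OF inv_psd])
      with pos have "0 < ?t" by simp
      from le[OF this, of i] G0 pos have "2 * cmod (?b $ i) + Re (G l $ i $ i) * cmod (?b $ i) \<le> 0"
        by (simp add: field_simps)
      with pos mult_nonneg_nonneg[OF G0 less_imp_le[OF pos]] show False by linarith
    qed
    then have "?b = 0" by (simp add: vec_eq_iff)
    then show ?case using vF(2)[of "?X l"] by simp
  qed
  then have "fcoef ?X k $ i = 0" for k i
    unfolding fcoef_def vec_lambda_beta
    by (subst integral_cong_AE[where g = "\<lambda>_. 0"])
       (auto elim!: eventually_mono intro!: borel_measurable_times borel_measurable_vec_nth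
         measurable_circ[OF trig_vec_measurable] fexp_measurable_circ)
  then have "unstack x k $ i = 0" if "k \<in> S" for k i
    using fcoef_trig_vec[OF S that, of "unstack x"] by metis
  then show "\<forall>p\<in>S \<times> UNIV. x p = 0" by (auto simp: unstack_def)
qed

text \<open>Invertibility ensures that the choice in \<open>mat_inv_on\<close> returns a genuine
  inverse, so its product with y really solves the system on the index set.\<close>

lemma Bmat_solution:
  assumes S: "finite S" and p: "p \<in> S \<times> UNIV"
  shows "mvec (S \<times> UNIV) (Bmat f g) (mvec (S \<times> UNIV) (mat_inv_on (S \<times> UNIV) (Bmat f g)) y) p = y p"
proof -
  let ?I = "S \<times> (UNIV :: 't set)" and ?B = "Bmat f g"
  let ?N = "mat_inv_on ?I ?B"
  have "is_inv_on ?I ?B ?N"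
    using Bmat_invertible[OF S] unfolding invertible_on_def mat_inv_on_def by (rule someI_ex)
  then have N: "(\<Sum>r\<in>?I. ?B p r * ?N r q) = (if p = q then 1 else 0)" if "q \<in> ?I" for q
    using p that unfolding is_inv_on_def by blast
  have "mvec ?I ?B (mvec ?I ?N y) p = (\<Sum>r\<in>?I. \<Sum>q\<in>?I. ?B p r * ?N r q * y q)"
    by (simp add: mvec_def sum_distrib_left mult.assoc)
  also have "\<dots> = (\<Sum>q\<in>?I. (\<Sum>r\<in>?I. ?B p r * ?N r q) * y q)"
    unfolding sum_distrib_right by (rule sum.swap)
  also have "\<dots> = (\<Sum>q\<in>?I. if p = q then y q else 0)"
    by (rule sum.cong) (auto simp: N)
  also have "\<dots> = y p" using S p by simp
  finally show ?thesis .
qed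

lemma Delta_circ:
  "Delta f g A h = 1 / (2 * pi) * (\<integral>l. Re (qform (A l - h l) (f l)) \<partial>circ)
     + 1 / (2 * pi) * (\<integral>l. Re (qform (h l) (g l)) \<partial>circ)"
  by (simp add: Delta_def set_integral_circ)

lemma L2_imp_int:
  assumes "L2 F b"
  shows "integrable circ (\<lambda>l. Re (qform (b l) (f l)))" "integrable circ (\<lambda>l. Re (qform (b l) (g l)))"
proof -
  have m: "b \<in> borel_measurable circ" and i: "integrable circ (\<lambda>l. Re (qform (b l) (F l)))"
    using assms by (auto simp: L2_iff intro: measurable_circ)
  show "integrable circ (\<lambda>l. Re (qform (b l) (f l)))"
  proof (rule Bochner_Integration.integrable_bound[OF i])
    show "AE l in circ. norm (Re (qform (b l) (f l))) \<le> norm (Re (qform (b l) (F l)))"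
      using pair_AE
    proof eventually_elim
      case (elim l)
      from psd_pair.qform_f_le[OF elim, of "b l"] herm_psdD(2)[OF psd_pair.f[OF elim], of "b l"]
      show ?case by simp
    qed
  qed (intro borel_measurable_Re_qform m measurable_circ f_meas)
  show "integrable circ (\<lambda>l. Re (qform (b l) (g l)))"
  proof (rule Bochner_Integration.integrable_bound[OF i])
    show "AE l in circ. norm (Re (qform (b l) (g l))) \<le> norm (Re (qform (b l) (F l)))"
      using pair_AE
    proof eventually_elim
      case (elim l)
      from psd_pair.qform_g_le[OF elim, of "b l"] herm_psdD(2)[OF psd_pair.g[OF elim], of "b l"]
      show ?case by simp
    qed
  qed (intro borel_measurable_Re_qform m measurable_circ g_meas)
qed

section \<open>The optimal estimate, for any coefficients c solving B c = D a\<close>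

context
  fixes S :: "int set" and a c :: "int \<Rightarrow> complex^'t"
  assumes S: "finite S"
    and c: "\<And>p. p \<in> S \<times> UNIV \<Longrightarrow>
      mvec (S \<times> UNIV) (Bmat f g) (stack c) p = mvec (S \<times> UNIV) (Dmat f g) (stack a) p"
begin

abbreviation "A \<equiv> trig_vec S a"
abbreviation "C \<equiv> trig_vec S c"
abbreviation "h \<equiv> (\<lambda>l. (A l v* f l - C l) v* G l)"

text \<open>Split h into A f G and C G. The F-form of the first is at most the f-form of A, and that
  of the second is the G-form of C; both are integrable because A and C are bounded.\<close>

lemma L2_h: "L2 F h"
proof -
  have m: "h \<in> borel_measurable lborel"
    by (intro borel_measurable_vector_matrix_mult borel_measurable_diff trig_vec_measurable f_meas G_meas)
  have "integrable circ (\<lambda>l. Re (qform (h l) (F l)))"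
  proof (rule Bochner_Integration.integrable_bound)
    have "integrable circ (\<lambda>l. Re (qform (A l) (f l)))"
      by (rule L2_imp_int[OF L2_trig_vec])
    moreover have "integrable circ (\<lambda>l. qform (C l) (G l))"
      by (rule integrable_qform_trig_vec[OF G_int])
    ultimately show "integrable circ (\<lambda>l. 2 * Re (qform (A l) (f l)) + 2 * Re (qform (C l) (G l)))"
      by simp
    show "AE l in circ. norm (Re (qform (h l) (F l))) \<le> norm (2 * Re (qform (A l) (f l)) + 2 * Re (qform (C l) (G l)))"
      using pair_AE
    proof eventually_elim
      case (elim l)
      interpret psd_pair "f l" "g l" "G l" by (rule elim)
      have "Re (qform (h l) (F l)) \<le> 2 * Re (qform (A l v* f l v* G l) (F l)) + 2 * Re (qform (C l v* G l) (F l))"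
        unfolding vector_matrix_mult_diff_distrib by (rule qform_diff_le[OF sum_psd])
      with qform_fG_le[of "A l"] herm_psdD(2)[OF sum_psd, of "h l"] arg_cong[OF qform_F_G[of "C l"], of Re]
      show ?case unfolding real_norm_def by linarith
    qed
  qed (rule Re_qform_meas[OF m])
  with m show ?thesis by (simp add: L2_iff)
qed

text \<open>On S the coefficients of A f G are the components of D a and those of C G are the
  components of B c, so the equation for c is exactly their cancellation.\<close>

lemma fcoef_h: "k \<in> S \<Longrightarrow> fcoef h k = 0"
proof (rule vec_eq_iff[THEN iffD2], rule allI)
  fix i assume k: "k \<in> S"
  have "h = (\<lambda>l. A l v* (f l ** G l) - C l v* G l)"
    by (simp add: vector_matrix_mult_diff_distrib vector_matrix_mul_assoc)
  then have "fcoef h k = fcoef (\<lambda>l. A l v* (f l ** G l)) k - fcoef (\<lambda>l. C l v* G l) k"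
    by (simp only: fcoef_diff integrable_trig_vec_mult fG_int G_int)
  then show "fcoef h k $ i = 0 $ i"
    using c[of "(k, i)"] k
    by (simp add: fcoef_trig_vec_mult fG_int G_int Bmat_toep Dmat_toep)
qed

lemma L2s_h: "L2s F S h"
  by (rule L2sI[OF L2_h S fcoef_h])

text \<open>\<open>error_expand\<close> with d = h' - h. Both estimates have vanishing coefficients
  on S, so Parseval kills the mixed term with C. Minimality and uniqueness of h are both read off
  from the excess.\<close>

lemma Delta_excess:
  assumes "L2s F S h'"
  shows "Delta f g A h' = Delta f g A h + 1 / (2 * pi) * L2dist F h' h"
proof -
  have h': "L2 F h'" using assms by (simp add: L2s_def)
  define d where "d l = h' l - h l" for l
  have d: "L2 F d" unfolding d_def by (rule L2_diff[OF h' L2_h])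
  have "fcoef d k = 0" if "k \<in> S" for k
    unfolding d_def using L2s_fcoef_zero[OF assms that] fcoef_h[OF that]
    by (subst fcoef_diff) (auto intro: L2_coordinate_int h' L2_h)
  then have cross: "(\<integral>l. cdot (C l) (d l) \<partial>circ) = 0"
    using parseval_trig_vec[OF S L2_coordinate_int[OF d], of c] by simp
  have cint: "integrable circ (\<lambda>l. cdot (C l) (d l))"
  proof -
    obtain K where K: "\<forall>l i. cmod (C l $ i) \<le> K" using trig_vec_bounded by blast
    have "integrable circ (\<lambda>l. C l $ i * cnj (d l $ i))" for i
    proof (rule Bochner_Integration.integrable_bound)
      show "integrable circ (\<lambda>l. K * cmod (d l $ i))"
        by (intro integrable_mult_right integrable_norm L2_coordinate_int d)
      show "(\<lambda>l. C l $ i * cnj (d l $ i)) \<in> borel_measurable circ"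
        by (intro borel_measurable_times borel_measurable_vec_nth measurable_circ[OF trig_vec_measurable]
          borel_measurable_integrable[OF integrable_cnj[OF L2_coordinate_int[OF d]]])
      have "0 \<le> K" using K norm_ge_zero order_trans by blast
      then show "AE l in circ. norm (C l $ i * cnj (d l $ i)) \<le> norm (K * cmod (d l $ i))"
        using K by (intro AE_I2) (simp add: norm_mult mult_right_mono)
    qed
    then show ?thesis unfolding cdot_def by simp
  qed
  note I = L2_imp_int(1)[OF L2_diff[OF L2_trig_vec h'], of S a] L2_imp_int(2)[OF h']
    L2_imp_int(1)[OF L2_diff[OF L2_trig_vec L2_h], of S a] L2_imp_int(2)[OF L2_h]
  have "(\<integral>l. Re (qform (A l - h' l) (f l)) \<partial>circ) + (\<integral>l. Re (qform (h' l) (g l)) \<partial>circ)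
     = (\<integral>l. Re (qform (A l - h' l) (f l)) + Re (qform (h' l) (g l)) \<partial>circ)"
    using I by simp
  also have "\<dots> = (\<integral>l. Re (qform (A l - h l) (f l)) + Re (qform (h l) (g l)) + Re (qform (d l) (F l))
       - 2 * Re (cdot (C l) (d l)) \<partial>circ)"
  proof (rule integral_cong_AE)
    show "AE l in circ. Re (qform (A l - h' l) (f l)) + Re (qform (h' l) (g l)) =
       Re (qform (A l - h l) (f l)) + Re (qform (h l) (g l)) + Re (qform (d l) (F l)) - 2 * Re (cdot (C l) (d l))"
      using pair_AE
    proof eventually_elim
      case (elim l)
      from psd_pair.error_expand[OF elim, of "A l" "C l" "d l"]
      show ?case by (simp add: d_def)
    qed
    show "(\<lambda>l. Re (qform (A l - h' l) (f l)) + Re (qform (h' l) (g l))) \<in> borel_measurable circ"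
      by (intro borel_measurable_add I[THEN borel_measurable_integrable])
    show "(\<lambda>l. Re (qform (A l - h l) (f l)) + Re (qform (h l) (g l)) + Re (qform (d l) (F l))
       - 2 * Re (cdot (C l) (d l))) \<in> borel_measurable circ"
      using d
      by (intro borel_measurable_diff borel_measurable_add borel_measurable_times borel_measurable_const
        I[THEN borel_measurable_integrable] integrable_Re[OF cint, THEN borel_measurable_integrable]
        Re_qform_meas) (simp add: L2_iff)
  qed
  also have "\<dots> = (\<integral>l. Re (qform (A l - h l) (f l)) \<partial>circ) + (\<integral>l. Re (qform (h l) (g l)) \<partial>circ)
     + (\<integral>l. Re (qform (d l) (F l)) \<partial>circ) - 2 * Re (\<integral>l. cdot (C l) (d l) \<partial>circ)"
    using I cint d by (simp add: L2_iff)
  also have "(\<integral>l. Re (qform (d l) (F l)) \<partial>circ) = L2dist F h' h"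
    by (simp add: L2dist_circ d_def)
  finally show ?thesis
    by (simp add: Delta_circ cross add_divide_distrib[symmetric])
qed

text \<open>Integrates \<open>error_value\<close>; the two resulting forms are those of R at a and
  of B at c by \<open>quadratic_form_toep\<close>. The equation is complex, which also records that
  the sum of the two scalar products is real.\<close>

lemma Delta_h:
  "complex_of_real (Delta f g A h) =
     cinner (S \<times> UNIV) (stack a) (mvec (S \<times> UNIV) (Rmat f g) (stack a))
     + cinner (S \<times> UNIV) (stack c) (mvec (S \<times> UNIV) (Bmat f g) (stack c))"
proof -
  note I = L2_imp_int(1)[OF L2_diff[OF L2_trig_vec L2_h], of S a] L2_imp_int(2)[OF L2_h]
  have i1: "integrable circ (\<lambda>l. qform (A l) (f l ** G l ** g l))"
    by (rule integrable_qform_trig_vec[OF fGg_int])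
  have i2: "integrable circ (\<lambda>l. qform (C l) (G l))"
    by (rule integrable_qform_trig_vec[OF G_int])
  have "Delta f g A h = 1 / (2 * pi) * (\<integral>l. Re (qform (A l - h l) (f l)) + Re (qform (h l) (g l)) \<partial>circ)"
    using I by (simp add: Delta_circ add_divide_distrib)
  then have "complex_of_real (Delta f g A h) = complex_of_real (1 / (2 * pi))
      * (\<integral>l. complex_of_real (Re (qform (A l - h l) (f l)) + Re (qform (h l) (g l))) \<partial>circ)"
    by (simp only: of_real_mult integral_complex_of_real)
  also have "(\<integral>l. complex_of_real (Re (qform (A l - h l) (f l)) + Re (qform (h l) (g l))) \<partial>circ)
      = (\<integral>l. qform (A l) (f l ** G l ** g l) + qform (C l) (G l) \<partial>circ)"
  proof (rule integral_cong_AE)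
    show "(\<lambda>l. complex_of_real (Re (qform (A l - h l) (f l)) + Re (qform (h l) (g l)))) \<in> borel_measurable circ"
      using I[THEN borel_measurable_integrable] by measurable
    show "(\<lambda>l. qform (A l) (f l ** G l ** g l) + qform (C l) (G l)) \<in> borel_measurable circ"
      using i1 i2 by (intro borel_measurable_add borel_measurable_integrable)
    show "AE l in circ. complex_of_real (Re (qform (A l - h l) (f l)) + Re (qform (h l) (g l)))
       = qform (A l) (f l ** G l ** g l) + qform (C l) (G l)"
      using pair_AE
    proof eventually_elim
      case (elim l)
      from psd_pair.error_value[OF elim, of "A l" "C l"]
      show ?case by (simp only: of_real_add qform_real psd_pair.f[OF elim] psd_pair.g[OF elim])
    qed
  qed
  also have "\<dots> = (\<integral>l. qform (A l) (f l ** G l ** g l) \<partial>circ) + (\<integral>l. qform (C l) (G l) \<partial>circ)"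
    using i1 i2 by (rule Bochner_Integration.integral_add)
  finally have *: "complex_of_real (Delta f g A h)
     = complex_of_real (1 / (2 * pi)) * (\<integral>l. qform (A l) (f l ** G l ** g l) \<partial>circ)
      + complex_of_real (1 / (2 * pi)) * (\<integral>l. qform (C l) (G l) \<partial>circ)"
    by (simp only: distrib_left)
  have herm: "AE l in circ. \<forall>i j. (f l ** G l ** g l) $ i $ j = cnj ((f l ** G l ** g l) $ j $ i)"
    using pair_AE by eventually_elim (simp only: psd_pair.fGg_hermitian simp_thms)
  from * show ?thesis
    unfolding Rmat_toep Bmat_toep quadratic_form_toep[OF S fGg_int herm] quadratic_form_toep[OF S G_int G_hermitian_AE] .
qed

end

end

text \<open>Optimality is expressed as minimality of \<open>Delta\<close> over the whole observation
  space, with any other minimizer at \<open>L2dist\<close> zero from h, since spectral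
  characteristics are determined only as elements of L2(F).\<close>

theorem theorem3p1:
  fixes f g :: "real \<Rightarrow> complex^'t^'t"
    and a :: "int \<Rightarrow> complex^'t"
    and s :: nat and N K :: "nat \<Rightarrow> nat"
  defines "S \<equiv> S_set s N K"
  defines "I \<equiv> S \<times> (UNIV :: 't set)"
  defines "F \<equiv> (\<lambda>l. f l + g l)"
  defines "A \<equiv> trig_vec S a"
  defines "c \<equiv> mvec I (mat_inv_on I (Bmat f g)) (mvec I (Dmat f g) (stack a))"
  defines "C \<equiv> trig_vec S (unstack c)"
  defines "h \<equiv> (\<lambda>l. (A l v* f l - C l) v* matrix_inv (F l))"
  assumes "s \<ge> 1"
    and "\<forall>k\<in>{1..s}. N k \<ge> 1"
    and "\<forall>k\<in>{1..<s}. K k \<ge> 1"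
    and "spectral_density f" and "spectral_density g"
    and "AE l in lborel. l \<in> {-pi..pi} \<longrightarrow> invertible (F l)"
    and "set_integrable lborel {-pi..pi} (\<lambda>l. trace (matrix_inv (F l)))"
  shows "invertible_on I (Bmat f g)
    \<and> (AE l in lborel. l \<in> {-pi..pi} \<longrightarrow>
         h l = A l - (A l v* g l + C l) v* matrix_inv (F l))
    \<and> L2s F S h
    \<and> (\<forall>h'. L2s F S h' \<longrightarrow> Delta f g A h \<le> Delta f g A h')
    \<and> (\<forall>h'. L2s F S h' \<and> Delta f g A h' = Delta f g A h \<longrightarrow> L2dist F h' h = 0)
    \<and> complex_of_real (Delta f g A h) =
        cinner I (stack a) (mvec I (Rmat f g) (stack a)) + cinner I c (mvec I (Bmat f g) c)"
proof -
  interpret mp: minimal_pair f g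
  proof
    show "AE l in circ. invertible (f l + g l)"
      using assms(13) unfolding AE_circ F_def .
    show "integrable circ (\<lambda>l. trace (matrix_inv (f l + g l)))"
      using assms(14) unfolding set_integrable_circ F_def .
  qed (rule assms(11,12))+
  have S: "finite S" by (simp add: S_def S_set_def)
  have c: "mvec (S \<times> UNIV) (Bmat f g) (stack (unstack c)) p = mvec (S \<times> UNIV) (Dmat f g) (stack a) p"
    if "p \<in> S \<times> UNIV" for p
    unfolding mp.stack_unstack c_def I_def by (rule mp.Bmat_solution[OF S that])
  have excess: "Delta f g A h' = Delta f g A h + 1 / (2 * pi) * L2dist F h' h" if "L2s F S h'" for h'
    using mp.Delta_excess[OF S c, of h'] that unfolding A_def C_def h_def F_def by blast
  show ?thesis
    unfolding AE_circ
  proof (intro conjI allI impI)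
    show "invertible_on I (Bmat f g)"
      unfolding I_def by (rule mp.Bmat_invertible[OF S])
    show "AE l in circ. h l = A l - (A l v* g l + C l) v* matrix_inv (F l)"
      using mp.pair_AE
    proof eventually_elim
      case (elim l)
      from psd_pair.estimate_eq[OF this] show ?case unfolding h_def F_def .
    qed
    show "L2s F S h"
      using mp.L2s_h[OF S c] unfolding A_def C_def h_def F_def by blast
    show "Delta f g A h \<le> Delta f g A h'" if "L2s F S h'" for h'
      using excess[OF that] mp.L2dist_nonneg[of h' h] unfolding F_def by simp
    show "L2dist F h' h = 0" if "L2s F S h' \<and> Delta f g A h' = Delta f g A h" for h'
      using excess[OF conjunct1[OF that]] conjunct2[OF that] by simp
    show "complex_of_real (Delta f g A h) =
        cinner I (stack a) (mvec I (Rmat f g) (stack a)) + cinner I c (mvec I (Bmat f g) c)"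
      using mp.Delta_h[OF S c] unfolding A_def C_def h_def F_def I_def mp.stack_unstack by blast
  qed
qed

end
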